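(* For $n\geq 6$, the ring $S_n/J_n$ is rigid, that is, $T^1(S_n/J_n)=0$.
   Context: Let $\mathbb{K}$ be an algebraically closed field and $S_n=\mathbb{K}[x_{ij},y_1,\ldots,y_n]_{1\leq i<j\leq n}$. Put $x_{ji}=-x_{ij}$ for $i<j$ and $x_{ii}=0$. For $1\leq i<j<k<l\leq n$ let $\Phi_{ijkl}=x_{ij}x_{kl}-x_{ik}x_{jl}+x_{il}x_{jk}$, and for $1\leq i\leq n$ let $f_i=\sum_{j=1}^n x_{ij}y_j$. Then $J_n\subset S_n$ is the ideal generated by all $\Phi_{ijkl}$ ($1\leq i<j<k<l\leq n$) and $f_1,\ldots,f_n$. For a smooth finitely generated $\mathbb{K}$-algebra $S$ and an ideal $I\subset S$, the first cotangent cohomology $T^1(S/I)$ is the cokernel of the map $$\mathrm{Der}_{\mathbb{K}}(S,S)\to \mathrm{Hom}_S(I,S/I)$$ sending a $\mathbb{K}$-linear derivation $\partial$ to the homomorphism $f\mapsto \partial(f)+I$. The ring $S/I$ is called rigid if $T^1(S/I)=0$. *)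

theory Defs
  imports
    "HOL-Algebra.QuotRing"
    "HOL-Algebra.Module"
    "HOL-Algebra.Elementary_Groups"
    "HOL-Algebra.Algebraic_Closure_Type"
    "HOL-Library.Poly_Mapping"
begin

section \<open>First cotangent cohomology\<close>

text \<open>
  Below, \<open>K\<close> is a commutative ring (a field in the application), \<open>S\<close> a \<open>K\<close>-algebra given as a
  \<open>module\<close> record and \<open>I\<close> an ideal of \<open>S\<close>. The functions in derivation and homomorphism modules
  are extensional, so that equality of functions is equality on the relevant carrier.
\<close>

definition Der :: "('k, 'm) ring_scheme \<Rightarrow> ('k, 'a, 'n) module_scheme \<Rightarrow> ('a \<Rightarrow> 'a) set" where
  "Der K S = {d \<in> carrier S \<rightarrow>\<^sub>E carrier S.
     (\<forall>f\<in>carrier S. \<forall>g\<in>carrier S. d (f \<oplus>\<^bsub>S\<^esub> g) = d f \<oplus>\<^bsub>S\<^esub> d g) \<and>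
     (\<forall>c\<in>carrier K. \<forall>f\<in>carrier S. d (c \<odot>\<^bsub>S\<^esub> f) = c \<odot>\<^bsub>S\<^esub> d f) \<and>
     (\<forall>f\<in>carrier S. \<forall>g\<in>carrier S. d (f \<otimes>\<^bsub>S\<^esub> g) = f \<otimes>\<^bsub>S\<^esub> d g \<oplus>\<^bsub>S\<^esub> g \<otimes>\<^bsub>S\<^esub> d f)}"

text \<open>
  The \<open>module\<close> record extends \<open>ring\<close>; its fields \<open>mult\<close> and \<open>one\<close> play no role for a module and
  are left undefined in \<open>Hom_module\<close>.
\<close>

definition quot_module :: "('a, 'm) ring_scheme \<Rightarrow> 'a set \<Rightarrow> ('a, 'a set) module" where
  "quot_module S I = \<lparr>carrier = carrier (S Quot I), monoid.mult = monoid.mult (S Quot I), one = \<one>\<^bsub>S Quot I\<^esub>,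
     zero = \<zero>\<^bsub>S Quot I\<^esub>, add = add (S Quot I),
     module.smult = (\<lambda>a u. (I +>\<^bsub>S\<^esub> a) \<otimes>\<^bsub>S Quot I\<^esub> u)\<rparr>"

definition Hom_module ::
    "('a, 'm) ring_scheme \<Rightarrow> 'a set \<Rightarrow> ('a, 'b, 'n) module_scheme \<Rightarrow> ('a, 'a \<Rightarrow> 'b) module" where
  "Hom_module S I M = \<lparr>
     carrier = {\<phi> \<in> I \<rightarrow>\<^sub>E carrier M.
       (\<forall>f\<in>I. \<forall>g\<in>I. \<phi> (f \<oplus>\<^bsub>S\<^esub> g) = \<phi> f \<oplus>\<^bsub>M\<^esub> \<phi> g) \<and>
       (\<forall>a\<in>carrier S. \<forall>f\<in>I. \<phi> (a \<otimes>\<^bsub>S\<^esub> f) = a \<odot>\<^bsub>M\<^esub> \<phi> f)},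
     monoid.mult = undefined, one = undefined,
     zero = (\<lambda>f\<in>I. \<zero>\<^bsub>M\<^esub>),
     add = (\<lambda>\<phi> \<psi>. \<lambda>f\<in>I. \<phi> f \<oplus>\<^bsub>M\<^esub> \<psi> f),
     module.smult = (\<lambda>a \<phi>. \<lambda>f\<in>I. a \<odot>\<^bsub>M\<^esub> \<phi> f)\<rparr>"

definition der_to_Hom :: "('a, 'm) ring_scheme \<Rightarrow> 'a set \<Rightarrow> ('a \<Rightarrow> 'a) \<Rightarrow> 'a \<Rightarrow> 'a set" where
  "der_to_Hom S I d = (\<lambda>f\<in>I. I +>\<^bsub>S\<^esub> d f)"

text \<open>
  The cokernel is taken as a quotient of additive groups; by \<open>submodule_der_to_Hom\<close> below, the
  subgroup divided out is an \<open>S\<close>-submodule, and the \<open>S\<close>-action is irrelevant for vanishing.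
\<close>

definition T1 :: "('k, 'm) ring_scheme \<Rightarrow> ('k, 'a, 'n) module_scheme \<Rightarrow> 'a set
    \<Rightarrow> ('a \<Rightarrow> 'a set) set monoid" where
  "T1 K S I = Hom_module S I (quot_module S I) A_Mod (der_to_Hom S I ` Der K S)"

definition rigid :: "('k, 'm) ring_scheme \<Rightarrow> ('k, 'a, 'n) module_scheme \<Rightarrow> 'a set \<Rightarrow> bool" where
  "rigid K S I \<longleftrightarrow> trivial_group (T1 K S I)"


section \<open>The rings $S_n$ and the ideals $J_n$\<close>

text \<open>
  Polynomials are finitely supported functions on monomials, which are in turn finitely supported
  exponent functions. The type \<open>'k mpoly\<close> has infinitely many indeterminates; the carrier of
  \<open>S_alg n\<close> restricts to those of $S_n$.
\<close>

datatype indet = XVar nat nat | YVar nat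

type_synonym 'k mpoly = "(indet \<Rightarrow>\<^sub>0 nat) \<Rightarrow>\<^sub>0 'k"

definition Var :: "indet \<Rightarrow> 'k::comm_ring_1 mpoly" where
  "Var v = Poly_Mapping.single (Poly_Mapping.single v 1) 1"

definition vars_S :: "nat \<Rightarrow> indet set" where
  "vars_S n = {XVar i j | i j. 1 \<le> i \<and> i < j \<and> j \<le> n} \<union> {YVar i | i. 1 \<le> i \<and> i \<le> n}"

definition S_alg :: "nat \<Rightarrow> ('k::comm_ring_1, 'k mpoly) module" where
  "S_alg n = \<lparr>carrier = {p. \<forall>m\<in>Poly_Mapping.keys p. Poly_Mapping.keys m \<subseteq> vars_S n},
     monoid.mult = (*), one = 1, zero = 0, add = (+),
     module.smult = (\<lambda>c p. Poly_Mapping.single 0 c * p)\<rparr>"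

definition x_poly :: "nat \<Rightarrow> nat \<Rightarrow> 'k::comm_ring_1 mpoly" where
  "x_poly i j = (if i < j then Var (XVar i j) else if j < i then - Var (XVar j i) else 0)"

definition y_poly :: "nat \<Rightarrow> 'k::comm_ring_1 mpoly" where
  "y_poly i = Var (YVar i)"

definition \<Phi>_poly :: "nat \<Rightarrow> nat \<Rightarrow> nat \<Rightarrow> nat \<Rightarrow> 'k::comm_ring_1 mpoly" where
  "\<Phi>_poly i j k l = x_poly i j * x_poly k l - x_poly i k * x_poly j l + x_poly i l * x_poly j k"

definition f_poly :: "nat \<Rightarrow> nat \<Rightarrow> 'k::comm_ring_1 mpoly" where
  "f_poly n i = (\<Sum>j=1..n. x_poly i j * y_poly j)"

definition J_ideal :: "nat \<Rightarrow> 'k::comm_ring_1 mpoly set" where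
  "J_ideal n = genideal (S_alg n)
     ({\<Phi>_poly i j k l | i j k l. 1 \<le> i \<and> i < j \<and> j < k \<and> k < l \<and> l \<le> n} \<union> {f_poly n i | i. 1 \<le> i \<and> i \<le> n})"


section \<open>Well-definedness\<close>

lemma S_alg_simps:
  "p \<otimes>\<^bsub>S_alg n\<^esub> q = p * q" "p \<oplus>\<^bsub>S_alg n\<^esub> q = p + q"
  "\<one>\<^bsub>S_alg n\<^esub> = 1" "\<zero>\<^bsub>S_alg n\<^esub> = 0"
  "c \<odot>\<^bsub>S_alg n\<^esub> p = Poly_Mapping.single 0 c * p"
  by (simp_all add: S_alg_def)

lemma carrier_S_mult:
  assumes "p \<in> carrier (S_alg n)" "q \<in> carrier (S_alg n)"
  shows "p * q \<in> carrier (S_alg n :: ('k::comm_ring_1, _) module)"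
proof -
  have "Poly_Mapping.keys m \<subseteq> vars_S n" if m: "m \<in> Poly_Mapping.keys (p * q)" for m
  proof -
    obtain a b where ab: "m = a + b" "a \<in> Poly_Mapping.keys p" "b \<in> Poly_Mapping.keys q"
      using m Poly_Mapping.keys_mult[of p q] by blast
    then have "Poly_Mapping.keys a \<subseteq> vars_S n" "Poly_Mapping.keys b \<subseteq> vars_S n"
      using assms by (auto simp: S_alg_def)
    then show ?thesis
      using Poly_Mapping.keys_add[of a b] ab(1) by blast
  qed
  then show ?thesis by (simp add: S_alg_def)
qed

lemma carrier_S_add:
  assumes "p \<in> carrier (S_alg n)" "q \<in> carrier (S_alg n)"
  shows "p + q \<in> carrier (S_alg n :: ('k::comm_ring_1, _) module)"
proof -
  have "Poly_Mapping.keys m \<subseteq> vars_S n" if "m \<in> Poly_Mapping.keys (p + q)" for m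
    using that assms Poly_Mapping.keys_add[of p q] by (auto simp: S_alg_def)
  then show ?thesis by (simp add: S_alg_def)
qed

lemma carrier_S_const:
  "Poly_Mapping.single 0 c \<in> carrier (S_alg n :: ('k::comm_ring_1, _) module)"
  unfolding S_alg_def by auto

lemma carrier_S_zero: "0 \<in> carrier (S_alg n :: ('k::comm_ring_1, _) module)"
  using carrier_S_const[of 0] by simp

lemma carrier_S_one: "1 \<in> carrier (S_alg n :: ('k::comm_ring_1, _) module)"
  using carrier_S_const[of 1] by simp

lemma carrier_S_uminus:
  assumes "p \<in> carrier (S_alg n)"
  shows "- p \<in> carrier (S_alg n :: ('k::comm_ring_1, _) module)"
proof -
  have "- p = Poly_Mapping.single 0 (- 1) * p"
    by (simp add: Poly_Mapping.single_uminus)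
  then show ?thesis using carrier_S_mult[OF carrier_S_const assms] by metis
qed

lemmas carrier_S_closed =
  carrier_S_mult carrier_S_add carrier_S_const carrier_S_zero carrier_S_one carrier_S_uminus

lemma cring_S: "cring (S_alg n :: ('k::comm_ring_1, _) module)"
proof (rule cringI)
  show "abelian_group (S_alg n :: ('k, _) module)"
  proof (rule abelian_groupI)
    show "\<exists>b\<in>carrier (S_alg n). b \<oplus>\<^bsub>S_alg n\<^esub> a = \<zero>\<^bsub>S_alg n\<^esub>"
      if "a \<in> carrier (S_alg n)" for a :: "'k mpoly"
      using carrier_S_uminus[OF that] by (intro bexI[of _ "- a"]) (auto simp: S_alg_simps)
  qed (auto simp: S_alg_simps carrier_S_closed algebra_simps)
  show "comm_monoid (S_alg n :: ('k, _) module)"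
    by (rule comm_monoidI) (auto simp: S_alg_simps carrier_S_closed algebra_simps)
qed (auto simp: S_alg_simps algebra_simps)

lemma algebra_S: "algebra ring_of_type_algebra (S_alg n :: ('k::comm_ring_1, _) module)"
proof (rule algebraI)
  show "cring (ring_of_type_algebra :: 'k ring)"
    by (rule cring_from_type_algebra)
  show "(a \<otimes>\<^bsub>ring_of_type_algebra\<^esub> b) \<odot>\<^bsub>S_alg n\<^esub> p = a \<odot>\<^bsub>S_alg n\<^esub> (b \<odot>\<^bsub>S_alg n\<^esub> p)"
    for a b :: 'k and p
    by (simp add: S_alg_def ring_of_type_algebra_def Poly_Mapping.mult_single flip: mult.assoc)
qed (auto simp: cring_S S_alg_simps carrier_S_closed
    ring_of_type_algebra_def Poly_Mapping.single_add distrib_left distrib_right mult.assoc)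

lemma carrier_S_Var: "Var v \<in> carrier (S_alg n :: ('k::comm_ring_1, _) module) \<longleftrightarrow> v \<in> vars_S n"
  by (simp add: Var_def S_alg_def)

lemma carrier_S_x:
  assumes "i \<in> {1..n}" "j \<in> {1..n}"
  shows "x_poly i j \<in> carrier (S_alg n :: ('k::comm_ring_1, _) module)"
proof -
  have *: "Var (XVar i j) \<in> carrier (S_alg n :: ('k, _) module)"
    if "i < j" "i \<in> {1..n}" "j \<in> {1..n}" for i j
    using that unfolding carrier_S_Var by (auto simp: vars_S_def)
  show ?thesis
    using assms by (auto simp: x_poly_def carrier_S_zero intro!: * carrier_S_uminus)
qed

lemma carrier_S_sum:
  assumes "\<And>i. i \<in> A \<Longrightarrow> p i \<in> carrier (S_alg n)"
  shows "sum p A \<in> carrier (S_alg n :: ('k::comm_ring_1, _) module)"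
  using assms
  by (induction A rule: infinite_finite_induct) (simp_all add: carrier_S_add carrier_S_zero)

lemma ideal_J: "ideal (J_ideal n) (S_alg n :: ('k::comm_ring_1, _) module)"
proof -
  interpret cring "S_alg n :: ('k, _) module" by (rule cring_S)
  have "\<Phi>_poly i j k l \<in> carrier (S_alg n :: ('k, _) module)"
    if "1 \<le> i" "i < j" "j < k" "k < l" "l \<le> n" for i j k l
    unfolding \<Phi>_poly_def diff_conv_add_uminus using that
    by (intro carrier_S_add carrier_S_uminus carrier_S_mult carrier_S_x) auto
  moreover have "f_poly n i \<in> carrier (S_alg n :: ('k, _) module)" if "1 \<le> i" "i \<le> n" for i
    unfolding f_poly_def y_poly_def using that
    by (intro carrier_S_sum carrier_S_mult carrier_S_x iffD2[OF carrier_S_Var]) (auto simp: vars_S_def)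
  ultimately show ?thesis
    unfolding J_ideal_def by (intro genideal_ideal) auto
qed

lemma module_quot_module:
  assumes "cring S" "ideal I S"
  shows "module S (quot_module S I)"
proof -
  interpret S: cring S by fact
  interpret I: ideal I S by fact
  interpret Q: cring "S Quot I" by (rule I.quotient_is_cring[OF assms(1)])
  have h: "(+>\<^bsub>S\<^esub>) I \<in> ring_hom S (S Quot I)" by (rule I.rcos_ring_hom)
  note hs = ring_hom_closed[OF h] ring_hom_add[OF h] ring_hom_mult[OF h] ring_hom_one[OF h]
  show ?thesis
  proof (rule moduleI)
    show "abelian_group (quot_module S I)"
    proof (rule abelian_groupI)
      fix u assume "u \<in> carrier (quot_module S I)"
      then show "\<exists>v\<in>carrier (quot_module S I). v \<oplus>\<^bsub>quot_module S I\<^esub> u = \<zero>\<^bsub>quot_module S I\<^esub>"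
        by (intro bexI[of _ "\<ominus>\<^bsub>S Quot I\<^esub> u"]) (simp_all add: quot_module_def Q.l_neg)
    qed (simp_all add: quot_module_def Q.a_ac)
  qed (simp_all add: quot_module_def hs Q.l_distr Q.r_distr Q.m_assoc S.is_cring)
qed

lemma module_Hom_module:
  assumes "cring S" "ideal I S" "module S M"
  shows "module S (Hom_module S I M)"
proof -
  interpret M: module S M by fact
  interpret I: ideal I S by fact
  have neg: "(\<lambda>f\<in>I. \<ominus>\<^bsub>M\<^esub> \<phi> f) \<in> carrier (Hom_module S I M)"
    if "\<phi> \<in> carrier (Hom_module S I M)" for \<phi>
    using that by (auto simp: Hom_module_def PiE_iff I.I_l_closed M.minus_add M.smult_r_minus)
  show ?thesis
  proof (rule moduleI)
    show "abelian_group (Hom_module S I M)"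
    proof (rule abelian_groupI)
      fix \<phi> assume \<phi>: "\<phi> \<in> carrier (Hom_module S I M)"
      show "\<exists>\<psi>\<in>carrier (Hom_module S I M). \<psi> \<oplus>\<^bsub>Hom_module S I M\<^esub> \<phi> = \<zero>\<^bsub>Hom_module S I M\<^esub>"
        using \<phi> by (intro bexI[OF _ neg[OF \<phi>]])
          (auto simp: Hom_module_def PiE_iff M.l_neg intro!: restrict_ext)
    qed (auto simp: Hom_module_def PiE_iff I.I_l_closed M.smult_r_distr M.a_ac fun_eq_iff
        extensional_def)
    show "a \<odot>\<^bsub>Hom_module S I M\<^esub> \<phi> \<in> carrier (Hom_module S I M)"
      if "a \<in> carrier S" "\<phi> \<in> carrier (Hom_module S I M)" for a \<phi>
    proof -
      have "a \<odot>\<^bsub>M\<^esub> (b \<odot>\<^bsub>M\<^esub> u) = b \<odot>\<^bsub>M\<^esub> (a \<odot>\<^bsub>M\<^esub> u)" if "b \<in> carrier S" "u \<in> carrier M" for b u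
        using \<open>a \<in> carrier S\<close> that by (metis M.m_comm M.smult_assoc1)
      then show ?thesis
        using that by (auto simp: Hom_module_def PiE_iff I.I_l_closed M.smult_r_distr)
    qed
  qed (use assms(1) in \<open>auto simp: Hom_module_def PiE_iff M.smult_r_distr M.smult_l_distr
      M.smult_assoc1 fun_eq_iff extensional_def\<close>)
qed

lemma submodule_der_to_Hom:
  assumes "algebra K S" "ideal I S"
  shows "submodule (der_to_Hom S I ` Der K S) S (Hom_module S I (quot_module S I))"
proof -
  interpret S: cring S by (rule algebra.axioms(2)[OF assms(1)])
  interpret A: algebra K S by fact
  interpret I: ideal I S by fact
  interpret Q: cring "S Quot I" by (rule I.quotient_is_cring[OF S.cring_axioms])
  let ?H = "Hom_module S I (quot_module S I)"
  interpret H: module S ?H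
    by (intro module_Hom_module module_quot_module S.cring_axioms assms(2))
  have h: "(+>\<^bsub>S\<^esub>) I \<in> ring_hom S (S Quot I)" by (rule I.rcos_ring_hom)
  note hs = ring_hom_closed[OF h] ring_hom_add[OF h] ring_hom_mult[OF h] ring_hom_zero[OF h]
  have coset0: "I +>\<^bsub>S\<^esub> u = \<zero>\<^bsub>S Quot I\<^esub>" if "u \<in> I" for u
    using that by (simp add: FactRing_def I.a_rcos_const)
  have closed: "der_to_Hom S I d \<in> carrier ?H" if d: "d \<in> Der K S" for d
  proof -
    have "I +>\<^bsub>S\<^esub> d (a \<otimes>\<^bsub>S\<^esub> g) = (I +>\<^bsub>S\<^esub> a) \<otimes>\<^bsub>S Quot I\<^esub> (I +>\<^bsub>S\<^esub> d g)"
      if "a \<in> carrier S" "g \<in> I" for a g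
    proof -
      have g: "g \<in> carrier S" "d a \<in> carrier S" "d g \<in> carrier S"
        using d that by (auto simp: Der_def)
      have "I +>\<^bsub>S\<^esub> d (a \<otimes>\<^bsub>S\<^esub> g) = I +>\<^bsub>S\<^esub> (a \<otimes>\<^bsub>S\<^esub> d g \<oplus>\<^bsub>S\<^esub> g \<otimes>\<^bsub>S\<^esub> d a)"
        using d that g by (simp add: Der_def)
      also have "\<dots> = (I +>\<^bsub>S\<^esub> a) \<otimes>\<^bsub>S Quot I\<^esub> (I +>\<^bsub>S\<^esub> d g)"
        using that g by (simp add: hs coset0 I.I_r_closed)
      finally show ?thesis .
    qed
    then show ?thesis
      using d by (auto simp: Hom_module_def quot_module_def der_to_Hom_def Der_def PiE_iff hs
          I.I_l_closed)
  qed
  have zero: "\<zero>\<^bsub>?H\<^esub> \<in> der_to_Hom S I ` Der K S"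
  proof (rule image_eqI)
    show "(\<lambda>f\<in>carrier S. \<zero>\<^bsub>S\<^esub>) \<in> Der K S"
      by (auto simp: Der_def)
    show "\<zero>\<^bsub>?H\<^esub> = der_to_Hom S I (\<lambda>f\<in>carrier S. \<zero>\<^bsub>S\<^esub>)"
      by (auto simp: Hom_module_def quot_module_def der_to_Hom_def coset0 intro!: restrict_ext)
  qed
  have add: "\<phi> \<oplus>\<^bsub>?H\<^esub> \<psi> \<in> der_to_Hom S I ` Der K S"
    if im: "\<phi> \<in> der_to_Hom S I ` Der K S" "\<psi> \<in> der_to_Hom S I ` Der K S" for \<phi> \<psi>
  proof -
    obtain d e where de: "d \<in> Der K S" "e \<in> Der K S"
      and eq: "\<phi> = der_to_Hom S I d" "\<psi> = der_to_Hom S I e"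
      using im by auto
    have c: "d f \<in> carrier S" "e f \<in> carrier S" if "f \<in> carrier S" for f
      using de that by (auto simp: Der_def)
    have "(\<lambda>f\<in>carrier S. d f \<oplus>\<^bsub>S\<^esub> e f) \<in> Der K S"
      using de by (auto simp: Der_def PiE_iff S.r_distr S.a_ac A.smult_r_distr)
    moreover have "\<phi> \<oplus>\<^bsub>?H\<^esub> \<psi> = der_to_Hom S I (\<lambda>f\<in>carrier S. d f \<oplus>\<^bsub>S\<^esub> e f)"
      by (auto simp: eq Hom_module_def quot_module_def der_to_Hom_def hs c intro!: restrict_ext)
    ultimately show ?thesis by blast
  qed
  have smult: "a \<odot>\<^bsub>?H\<^esub> \<phi> \<in> der_to_Hom S I ` Der K S"
    if im: "a \<in> carrier S" "\<phi> \<in> der_to_Hom S I ` Der K S" for a \<phi>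
  proof -
    obtain d where d: "d \<in> Der K S" and eq: "\<phi> = der_to_Hom S I d"
      using im by auto
    have c: "d f \<in> carrier S" if "f \<in> carrier S" for f
      using d that by (auto simp: Der_def)
    have sm: "a \<otimes>\<^bsub>S\<^esub> (k \<odot>\<^bsub>S\<^esub> u) = k \<odot>\<^bsub>S\<^esub> (a \<otimes>\<^bsub>S\<^esub> u)" if "k \<in> carrier K" "u \<in> carrier S" for k u
      using A.smult_assoc2[of k u a] that im(1) by (simp add: S.m_comm)
    have "(\<lambda>f\<in>carrier S. a \<otimes>\<^bsub>S\<^esub> d f) \<in> Der K S"
      using d im(1) by (auto simp: Der_def PiE_iff S.r_distr S.m_lcomm sm)
    moreover have "a \<odot>\<^bsub>?H\<^esub> \<phi> = der_to_Hom S I (\<lambda>f\<in>carrier S. a \<otimes>\<^bsub>S\<^esub> d f)"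
      using im(1)
      by (auto simp: eq Hom_module_def quot_module_def der_to_Hom_def hs c intro!: restrict_ext)
    ultimately show ?thesis by blast
  qed
  have neg: "\<ominus>\<^bsub>?H\<^esub> \<phi> \<in> der_to_Hom S I ` Der K S" if "\<phi> \<in> der_to_Hom S I ` Der K S" for \<phi>
  proof -
    have "\<phi> \<in> carrier ?H" using that closed by auto
    then have "\<ominus>\<^bsub>?H\<^esub> \<phi> = (\<ominus>\<^bsub>S\<^esub> \<one>\<^bsub>S\<^esub>) \<odot>\<^bsub>?H\<^esub> \<phi>"
      using H.smult_l_minus[of "\<one>\<^bsub>S\<^esub>" \<phi>] by simp
    then show ?thesis using smult[OF _ that] by simp
  qed
  show ?thesis
    by (intro H.submoduleI) (use closed zero add smult neg in auto)
qed

end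

(*
  Let R = S/J. A homomorphism from J to R is determined by the values F_ijkl of the Pfaffians and
  g_i of the f_i, and these inherit the syzygies of the generators. Adding derivations step by step,
  all values can be made zero. The syzygy sum_a +- x_1a Phi_1bcd = 0 shows that x_15 F_1234 lies in
  the ideal of R generated by the x_ij with i < j < 5. If x_15 is a nonzerodivisor modulo that ideal,
  then F_1234 lies in the ideal too, which says exactly that some derivation has the same value on
  Phi_1234. In the same way one removes F_123l (with x_14 modulo x_12, x_13, x_23), then F_12kl (with
  x_13 modulo x_12), hence all of F (with x_12), then g_1 (with x_23 modulo the x_1j), g_2 (x_13 modulo
  x_12) and finally all g_k (x_12).

  All these are instances of one statement: for s < t < n, the variable x_st is a nonzerodivisor
  modulo J and the Schubert ideal generated by the x_ij with i < s or j < t. The case t = 5 is what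
  forces n >= 6. It follows from a standard monomial basis of the quotient: standard monomials span
  by straightening, they are linearly independent because their images under a polynomial
  parametrisation have distinct leading monomials, and x_st times a standard monomial is standard.
*)
theory Submission
  imports Defs "HOL-Computational_Algebra.Polynomial"
begin

section \<open>Substitution and leading monomials\<close>

text \<open>The bound t < n is sharp: modulo the Schubert ideal with t = n every f_i with i < n
  becomes x_in y_n, so x_sn is a zero divisor. For n = 5 the first step would need exactly this
  case, with x_15.

  The Schubert ideals are dictated by partial derivatives. Those of Phi_1234 are, up to sign, the
  six x_ij with i < j < 5; those of Phi_123l in x_1l, x_2l, x_3l are x_23, x_13, x_12; that of
  Phi_12kl in x_kl is x_12; those of f_1 in the y_j are the x_1j; that of f_2 in y_1 is x_12. So a
  value in such an ideal is the value of a derivation, with the cofactors as its coefficients. The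
  order of the steps matters: every derivation moves only indeterminates on which the generators
  treated before do not depend, so zeros once achieved persist.

  Homomorphisms are handled through polynomial representatives that are linear modulo J only; cosets
  appear just in the last section.\<close>

lemma poly_mapping_eq_sum_single: "p = (\<Sum>m\<in>Poly_Mapping.keys p. Poly_Mapping.single m (Poly_Mapping.lookup p m))"
  by (rule poly_mapping_eqI)
    (auto simp: Poly_Mapping.lookup_sum Poly_Mapping.lookup_single when_def in_keys_iff
      intro: sum.neutral)

definition mon_subst :: "('v \<Rightarrow> 'r::comm_monoid_mult) \<Rightarrow> ('v \<Rightarrow>\<^sub>0 nat) \<Rightarrow> 'r" where
  "mon_subst \<sigma> m = (\<Prod>v\<in>Poly_Mapping.keys m. \<sigma> v ^ Poly_Mapping.lookup m v)"

definition mpoly_subst :: "('k \<Rightarrow> 'r) \<Rightarrow> ('v \<Rightarrow> 'r) \<Rightarrow> (('v \<Rightarrow>\<^sub>0 nat) \<Rightarrow>\<^sub>0 'k::zero) \<Rightarrow> 'r::comm_semiring_1" where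
  "mpoly_subst h \<sigma> p = (\<Sum>m\<in>Poly_Mapping.keys p. h (Poly_Mapping.lookup p m) * mon_subst \<sigma> m)"

lemma mon_subst_superset:
  assumes "finite A" "Poly_Mapping.keys m \<subseteq> A"
  shows "mon_subst \<sigma> m = (\<Prod>v\<in>A. \<sigma> v ^ Poly_Mapping.lookup m v)"
  unfolding mon_subst_def using assms
  by (intro prod.mono_neutral_left) (auto simp: in_keys_iff)

lemma mon_subst_zero [simp]: "mon_subst \<sigma> 0 = 1"
  by (simp add: mon_subst_def)

lemma mon_subst_add: "mon_subst \<sigma> (a + b) = mon_subst \<sigma> a * mon_subst \<sigma> b"
proof -
  let ?A = "Poly_Mapping.keys a \<union> Poly_Mapping.keys b"
  have "mon_subst \<sigma> (a + b) = (\<Prod>v\<in>?A. \<sigma> v ^ Poly_Mapping.lookup (a + b) v)"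
    by (rule mon_subst_superset) (use Poly_Mapping.keys_add[of a b] in auto)
  also have "\<dots> = (\<Prod>v\<in>?A. \<sigma> v ^ Poly_Mapping.lookup a v) * (\<Prod>v\<in>?A. \<sigma> v ^ Poly_Mapping.lookup b v)"
    by (simp add: Poly_Mapping.lookup_add power_add prod.distrib)
  also have "\<dots> = mon_subst \<sigma> a * mon_subst \<sigma> b"
    by (simp add: mon_subst_superset[of ?A])
  finally show ?thesis .
qed

lemma mon_subst_single [simp]: "mon_subst \<sigma> (Poly_Mapping.single v k) = \<sigma> v ^ k"
  by (cases "k = 0") (auto simp: mon_subst_def)

text \<open>The coefficient map is a parameter because substitution is used twice: into polynomials
  in the parameters of a Schubert variety, and into polynomials in \<epsilon> over
  \<open>'k mpoly\<close>, which produce derivations.\<close>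

locale coeff_hom =
  fixes h :: "'k::comm_ring_1 \<Rightarrow> 'r::comm_ring_1"
  assumes h_one [simp]: "h 1 = 1"
    and h_add: "h (a + b) = h a + h b"
    and h_mult: "h (a * b) = h a * h b"
begin

lemma h_zero [simp]: "h 0 = 0"
  using h_add[of 0 0] by simp

lemma mpoly_subst_superset:
  assumes "finite A" "Poly_Mapping.keys p \<subseteq> A"
  shows "mpoly_subst h \<sigma> p = (\<Sum>m\<in>A. h (Poly_Mapping.lookup p m) * mon_subst \<sigma> m)"
  unfolding mpoly_subst_def using assms
  by (intro sum.mono_neutral_left) (auto simp: in_keys_iff)

lemma mpoly_subst_zero [simp]: "mpoly_subst h \<sigma> 0 = 0"
  by (simp add: mpoly_subst_def)

lemma mpoly_subst_add: "mpoly_subst h \<sigma> (p + q) = mpoly_subst h \<sigma> p + mpoly_subst h \<sigma> q"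
proof -
  let ?A = "Poly_Mapping.keys p \<union> Poly_Mapping.keys q"
  have "mpoly_subst h \<sigma> (p + q) = (\<Sum>m\<in>?A. h (Poly_Mapping.lookup (p + q) m) * mon_subst \<sigma> m)"
    by (rule mpoly_subst_superset) (use Poly_Mapping.keys_add[of p q] in auto)
  also have "\<dots> = (\<Sum>m\<in>?A. h (Poly_Mapping.lookup p m) * mon_subst \<sigma> m) +
      (\<Sum>m\<in>?A. h (Poly_Mapping.lookup q m) * mon_subst \<sigma> m)"
    by (simp add: Poly_Mapping.lookup_add h_add distrib_right sum.distrib)
  also have "\<dots> = mpoly_subst h \<sigma> p + mpoly_subst h \<sigma> q"
    by (simp add: mpoly_subst_superset[of ?A])
  finally show ?thesis .
qed

lemma mpoly_subst_sum: "mpoly_subst h \<sigma> (sum f A) = (\<Sum>i\<in>A. mpoly_subst h \<sigma> (f i))"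
  by (induction A rule: infinite_finite_induct) (simp_all add: mpoly_subst_add)

lemma mpoly_subst_single [simp]: "mpoly_subst h \<sigma> (Poly_Mapping.single m c) = h c * mon_subst \<sigma> m"
  by (cases "c = 0") (auto simp: mpoly_subst_def)

lemma mpoly_subst_uminus: "mpoly_subst h \<sigma> (- p) = - mpoly_subst h \<sigma> p"
  using mpoly_subst_add[of \<sigma> p "- p"] by (simp add: eq_neg_iff_add_eq_0 add.commute)

lemma mpoly_subst_diff: "mpoly_subst h \<sigma> (p - q) = mpoly_subst h \<sigma> p - mpoly_subst h \<sigma> q"
  using mpoly_subst_add[of \<sigma> p "- q"] by (simp add: mpoly_subst_uminus)

lemma mpoly_subst_mult: "mpoly_subst h \<sigma> (p * q) = mpoly_subst h \<sigma> p * mpoly_subst h \<sigma> q"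
proof -
  let ?s = "\<lambda>p m. Poly_Mapping.single m (Poly_Mapping.lookup p m)"
  have "p * q = (\<Sum>a\<in>Poly_Mapping.keys p. ?s p a) * (\<Sum>b\<in>Poly_Mapping.keys q. ?s q b)"
    by (simp flip: poly_mapping_eq_sum_single)
  also have "mpoly_subst h \<sigma> \<dots> = mpoly_subst h \<sigma> (\<Sum>a\<in>Poly_Mapping.keys p. ?s p a) *
      mpoly_subst h \<sigma> (\<Sum>b\<in>Poly_Mapping.keys q. ?s q b)"
    by (simp add: sum_product mpoly_subst_sum Poly_Mapping.mult_single h_mult mon_subst_add mult_ac)
  finally show ?thesis
    by (simp flip: poly_mapping_eq_sum_single)
qed

lemmas mpoly_subst_hom =
  mpoly_subst_add mpoly_subst_sum mpoly_subst_uminus mpoly_subst_diff mpoly_subst_mult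

end

lemma coeff_hom_single: "coeff_hom (Poly_Mapping.single (0 :: 'm::comm_monoid_add) :: 'k::comm_ring_1 \<Rightarrow> _)"
  by unfold_locales (simp_all add: Poly_Mapping.single_add Poly_Mapping.mult_single)

section \<open>Weighted degrees and leading monomials\<close>

definition wdeg :: "('v \<Rightarrow> nat) \<Rightarrow> ('v \<Rightarrow>\<^sub>0 nat) \<Rightarrow> nat" where
  "wdeg wt m = (\<Sum>v\<in>Poly_Mapping.keys m. Poly_Mapping.lookup m v * wt v)"

lemma wdeg_zero [simp]: "wdeg wt 0 = 0"
  by (simp add: wdeg_def)

lemma wdeg_add: "wdeg wt (a + b) = wdeg wt a + wdeg wt b"
proof -
  let ?A = "Poly_Mapping.keys a \<union> Poly_Mapping.keys b"
  have *: "wdeg wt m = (\<Sum>v\<in>?A. Poly_Mapping.lookup m v * wt v)" if "Poly_Mapping.keys m \<subseteq> ?A" for m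
    unfolding wdeg_def using that by (intro sum.mono_neutral_left) (auto simp: in_keys_iff)
  show ?thesis
    using Poly_Mapping.keys_add[of a b]
    by (simp add: * Poly_Mapping.lookup_add distrib_right sum.distrib)
qed

lemma wdeg_single [simp]: "wdeg wt (Poly_Mapping.single v k) = k * wt v"
  by (cases "k = 0") (auto simp: wdeg_def)

definition wdeg_less :: "('v \<Rightarrow> nat) \<Rightarrow> nat \<Rightarrow> (('v \<Rightarrow>\<^sub>0 nat) \<Rightarrow>\<^sub>0 'k::zero) \<Rightarrow> bool" where
  "wdeg_less wt w p \<longleftrightarrow> (\<forall>m\<in>Poly_Mapping.keys p. wdeg wt m < w)"

lemma wdeg_less_zero [simp]: "wdeg_less wt w 0"
  by (simp add: wdeg_less_def)

lemma wdeg_less_single: "wdeg_less wt w (Poly_Mapping.single m c) \<longleftrightarrow> c = 0 \<or> wdeg wt m < w"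
  by (auto simp: wdeg_less_def)

lemma wdeg_less_mono: "wdeg_less wt w p \<Longrightarrow> w \<le> w' \<Longrightarrow> wdeg_less wt w' p"
  by (force simp: wdeg_less_def)

lemma wdeg_less_add:
  fixes p q :: "('v \<Rightarrow>\<^sub>0 nat) \<Rightarrow>\<^sub>0 'k::comm_monoid_add"
  shows "wdeg_less wt w p \<Longrightarrow> wdeg_less wt w q \<Longrightarrow> wdeg_less wt w (p + q)"
  using Poly_Mapping.keys_add[of p q] by (force simp: wdeg_less_def)

lemma wdeg_less_uminus [simp]:
  fixes p :: "('v \<Rightarrow>\<^sub>0 nat) \<Rightarrow>\<^sub>0 'k::ab_group_add"
  shows "wdeg_less wt w (- p) = wdeg_less wt w p"
  by (simp add: wdeg_less_def in_keys_iff)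

lemma wdeg_less_diff:
  fixes p q :: "('v \<Rightarrow>\<^sub>0 nat) \<Rightarrow>\<^sub>0 'k::ab_group_add"
  shows "wdeg_less wt w p \<Longrightarrow> wdeg_less wt w q \<Longrightarrow> wdeg_less wt w (p - q)"
  using wdeg_less_add[of wt w p "- q"] by simp

lemma wdeg_less_sum:
  fixes f :: "'i \<Rightarrow> ('v \<Rightarrow>\<^sub>0 nat) \<Rightarrow>\<^sub>0 'k::comm_monoid_add"
  shows "(\<And>i. i \<in> A \<Longrightarrow> wdeg_less wt w (f i)) \<Longrightarrow> wdeg_less wt w (sum f A)"
  by (induction A rule: infinite_finite_induct) (simp_all add: wdeg_less_add)

text \<open>\<open>Suc a\<close> turns the strict bound into a weak one: it is enough that one of
  the two factors stays strictly below its weight.\<close>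

lemma wdeg_less_mult:
  assumes "wdeg_less wt (Suc a) p" "wdeg_less wt b q"
  shows "wdeg_less wt (a + b) (p * q)"
  unfolding wdeg_less_def
proof
  fix m assume "m \<in> Poly_Mapping.keys (p * q)"
  then obtain x y where "m = x + y" "x \<in> Poly_Mapping.keys p" "y \<in> Poly_Mapping.keys q"
    using Poly_Mapping.keys_mult[of p q] by blast
  then show "wdeg wt m < a + b"
    using assms by (force simp: wdeg_less_def wdeg_add)
qed

text \<open>Only a unique monomial of top weight is asked for. Ties between lower monomials do not
  matter, so a weight in the natural numbers replaces a monomial order.\<close>

definition leads :: "('v \<Rightarrow> nat) \<Rightarrow> (('v \<Rightarrow>\<^sub>0 nat) \<Rightarrow>\<^sub>0 'k::idom) \<Rightarrow> ('v \<Rightarrow>\<^sub>0 nat) \<Rightarrow> bool" where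
  "leads wt p a \<longleftrightarrow> (\<exists>c. c \<noteq> 0 \<and> wdeg_less wt (wdeg wt a) (p - Poly_Mapping.single a c))"

lemma leads_one: "leads wt 1 0"
  unfolding leads_def by (rule exI[of _ 1]) simp

lemma leads_mult:
  assumes "leads wt p a" "leads wt q b"
  shows "leads wt (p * q) (a + b)"
proof -
  obtain c d where cd: "c \<noteq> 0" "d \<noteq> 0" "wdeg_less wt (wdeg wt a) (p - Poly_Mapping.single a c)"
    "wdeg_less wt (wdeg wt b) (q - Poly_Mapping.single b d)"
    using assms by (auto simp: leads_def)
  define p' q' where "p' = p - Poly_Mapping.single a c" and "q' = q - Poly_Mapping.single b d"
  have "p * q - Poly_Mapping.single (a + b) (c * d) = Poly_Mapping.single a c * q' + q * p'"
    by (simp add: p'_def q'_def algebra_simps flip: Poly_Mapping.mult_single)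
  moreover have "wdeg_less wt (wdeg wt a + wdeg wt b) (Poly_Mapping.single a c * q')"
    by (rule wdeg_less_mult) (use cd in \<open>auto simp: wdeg_less_single q'_def\<close>)
  moreover have "wdeg_less wt (wdeg wt b + wdeg wt a) (q * p')"
  proof (rule wdeg_less_mult)
    have "wdeg_less wt (Suc (wdeg wt b)) (q' + Poly_Mapping.single b d)"
      by (rule wdeg_less_add)
        (use cd in \<open>auto simp: wdeg_less_single q'_def intro: wdeg_less_mono\<close>)
    then show "wdeg_less wt (Suc (wdeg wt b)) q"
      by (simp add: q'_def)
  qed (use cd in \<open>simp add: p'_def\<close>)
  ultimately show ?thesis
    unfolding leads_def using cd
    by (intro exI[of _ "c * d"]) (auto simp: wdeg_add add.commute intro: wdeg_less_add)
qed

lemma leads_power: "leads wt p a \<Longrightarrow> leads wt (p ^ k) (\<Sum>_<k. a)"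
  by (induction k) (simp_all add: leads_one leads_mult add.commute)

lemma leads_prod:
  "(\<And>v. v \<in> A \<Longrightarrow> leads wt (f v) (g v)) \<Longrightarrow> leads wt (prod f A) (sum g A)"
  by (induction A rule: infinite_finite_induct) (simp_all add: leads_one leads_mult)

text \<open>The monomial map v -> g v on exponents. If g v is the leading monomial of \<sigma> v,
  this is the leading monomial of \<open>mon_subst \<sigma> m\<close>.\<close>

definition mon_comp :: "('v \<Rightarrow> 'u \<Rightarrow>\<^sub>0 nat) \<Rightarrow> ('v \<Rightarrow>\<^sub>0 nat) \<Rightarrow> 'u \<Rightarrow>\<^sub>0 nat" where
  "mon_comp g m = (\<Sum>v\<in>Poly_Mapping.keys m. \<Sum>_<Poly_Mapping.lookup m v. g v)"

lemma lookup_mon_comp: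
  assumes "finite A" "Poly_Mapping.keys m \<subseteq> A"
  shows "Poly_Mapping.lookup (mon_comp g m) u = (\<Sum>v\<in>A. Poly_Mapping.lookup m v * Poly_Mapping.lookup (g v) u)"
proof -
  have "Poly_Mapping.lookup (mon_comp g m) u =
      (\<Sum>v\<in>Poly_Mapping.keys m. Poly_Mapping.lookup m v * Poly_Mapping.lookup (g v) u)"
    by (simp add: mon_comp_def Poly_Mapping.lookup_sum)
  also have "\<dots> = (\<Sum>v\<in>A. Poly_Mapping.lookup m v * Poly_Mapping.lookup (g v) u)"
    using assms by (intro sum.mono_neutral_left) (auto simp: in_keys_iff)
  finally show ?thesis .
qed

lemma leads_mon_subst:
  assumes "\<And>v. v \<in> Poly_Mapping.keys m \<Longrightarrow> leads wt (\<sigma> v) (g v)"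
  shows "leads wt (mon_subst \<sigma> m) (mon_comp g m)"
  unfolding mon_subst_def mon_comp_def using assms by (intro leads_prod leads_power)

text \<open>Take m0 in q such that the leading monomial of its image has maximal weight. The
  coefficient of that monomial in the image of q comes from m0 alone: any other m has a different
  leading monomial, and its remaining terms are too light. The leading monomials must differ, but
  their weights may agree.\<close>

lemma mpoly_subst_eq_0_imp_eq_0:
  fixes q :: "('v \<Rightarrow>\<^sub>0 nat) \<Rightarrow>\<^sub>0 'k::idom" and \<sigma> :: "'v \<Rightarrow> ('u \<Rightarrow>\<^sub>0 nat) \<Rightarrow>\<^sub>0 'k"
  assumes 0: "mpoly_subst (Poly_Mapping.single 0) \<sigma> q = 0"
    and lead: "\<And>m v. m \<in> Poly_Mapping.keys q \<Longrightarrow> v \<in> Poly_Mapping.keys m \<Longrightarrow> leads wt (\<sigma> v) (g v)"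
    and inj: "inj_on (mon_comp g) (Poly_Mapping.keys q)"
  shows "q = 0"
proof (rule ccontr)
  assume "q \<noteq> 0"
  let ?W = "\<lambda>m. wdeg wt (mon_comp g m)"
  have ne: "?W ` Poly_Mapping.keys q \<noteq> {}" "finite (?W ` Poly_Mapping.keys q)"
    using \<open>q \<noteq> 0\<close> by simp_all
  obtain m0 where m0: "m0 \<in> Poly_Mapping.keys q" "?W m0 = Max (?W ` Poly_Mapping.keys q)"
    using Max_in[OF ne(2,1)] by auto
  have max: "?W m \<le> ?W m0" if "m \<in> Poly_Mapping.keys q" for m
    unfolding m0(2) using that by (intro Max_ge) auto
  let ?c = "\<lambda>m. Poly_Mapping.lookup (Poly_Mapping.single 0 (Poly_Mapping.lookup q m) * mon_subst \<sigma> m) (mon_comp g m0)"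
  have c: "\<exists>k. k \<noteq> 0 \<and> ?c m = (if m = m0 then Poly_Mapping.lookup q m * k else 0)" if m: "m \<in> Poly_Mapping.keys q" for m
  proof -
    have "leads wt (mon_subst \<sigma> m) (mon_comp g m)"
      using lead[OF m] by (rule leads_mon_subst)
    then obtain k where k: "k \<noteq> 0"
      "wdeg_less wt (?W m) (mon_subst \<sigma> m - Poly_Mapping.single (mon_comp g m) k)"
      by (auto simp: leads_def)
    define r where "r = mon_subst \<sigma> m - Poly_Mapping.single (mon_comp g m) k"
    have "wdeg_less wt (0 + ?W m) (Poly_Mapping.single 0 (Poly_Mapping.lookup q m) * r)"
      by (rule wdeg_less_mult) (use k in \<open>auto simp: wdeg_less_single r_def\<close>)
    then have "Poly_Mapping.lookup (Poly_Mapping.single 0 (Poly_Mapping.lookup q m) * r) (mon_comp g m0) = 0"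
      using max[OF m] by (auto simp: wdeg_less_def in_keys_iff not_less[symmetric])
    moreover have "mon_subst \<sigma> m = Poly_Mapping.single (mon_comp g m) k + r"
      by (simp add: r_def)
    ultimately have "?c m = Poly_Mapping.lookup (Poly_Mapping.single (mon_comp g m) (Poly_Mapping.lookup q m * k)) (mon_comp g m0)"
      by (simp add: distrib_left Poly_Mapping.mult_single Poly_Mapping.lookup_add)
    also have "\<dots> = (if m = m0 then Poly_Mapping.lookup q m * k else 0)"
      using inj_onD[OF inj _ m m0(1)] by (auto simp: Poly_Mapping.lookup_single when_def)
    finally show ?thesis using k(1) by blast
  qed
  have "0 = (\<Sum>m\<in>Poly_Mapping.keys q. ?c m)"
    using 0 by (simp add: mpoly_subst_def flip: Poly_Mapping.lookup_sum)
  also have "\<dots> = ?c m0 + (\<Sum>m\<in>Poly_Mapping.keys q - {m0}. ?c m)"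
    using m0(1) by (simp add: sum.remove)
  also have "(\<Sum>m\<in>Poly_Mapping.keys q - {m0}. ?c m) = 0"
    by (intro sum.neutral ballI) (metis (no_types, lifting) c DiffE insertI1)
  finally show False
    using c[OF m0(1)] m0(1) by (auto simp: in_keys_iff)
qed

section \<open>Straightening modulo Schubert ideals\<close>

lemma J_zero: "0 \<in> (J_ideal n :: 'k::comm_ring_1 mpoly set)"
  using additive_subgroup.zero_closed[OF ideal.axioms(1)[OF ideal_J]] by (simp add: S_alg_simps)

lemma J_add:
  fixes p q :: "'k::comm_ring_1 mpoly"
  shows "p \<in> J_ideal n \<Longrightarrow> q \<in> J_ideal n \<Longrightarrow> p + q \<in> J_ideal n"
  using additive_subgroup.a_closed[OF ideal.axioms(1)[OF ideal_J]] by (metis S_alg_simps(2))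

lemma J_mult:
  fixes p q :: "'k::comm_ring_1 mpoly"
  shows "p \<in> carrier (S_alg n) \<Longrightarrow> q \<in> J_ideal n \<Longrightarrow> p * q \<in> J_ideal n"
  using ideal.I_l_closed[OF ideal_J] by (metis S_alg_simps(1))

lemma J_uminus:
  fixes p :: "'k::comm_ring_1 mpoly"
  shows "p \<in> J_ideal n \<Longrightarrow> - p \<in> J_ideal n"
  using J_mult[of "- 1" n p] by (simp add: carrier_S_closed)

lemma J_diff:
  fixes p q :: "'k::comm_ring_1 mpoly"
  shows "p \<in> J_ideal n \<Longrightarrow> q \<in> J_ideal n \<Longrightarrow> p - q \<in> J_ideal n"
  using J_add[of p n "- q"] by (simp add: J_uminus)

lemma J_subset_carrier: "(J_ideal n :: 'k::comm_ring_1 mpoly set) \<subseteq> carrier (S_alg n)"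
  by (rule additive_subgroup.a_subset[OF ideal.axioms(1)[OF ideal_J]])

lemma carrier_S_diff:
  assumes "p \<in> carrier (S_alg n)" "q \<in> carrier (S_alg n)"
  shows "p - q \<in> carrier (S_alg n :: ('k::comm_ring_1, _) module)"
  using carrier_S_add[OF assms(1) carrier_S_uminus[OF assms(2)]] by simp

lemma carrier_S_y: "i \<in> {1..n} \<Longrightarrow> y_poly i \<in> carrier (S_alg n :: ('k::comm_ring_1, _) module)"
  by (auto simp: y_poly_def carrier_S_Var vars_S_def)

lemmas carrier_S_intros =
  carrier_S_closed carrier_S_diff carrier_S_sum carrier_S_x carrier_S_y

lemma carrier_S_Phi:
  assumes "i \<in> {1..n}" "j \<in> {1..n}" "k \<in> {1..n}" "l \<in> {1..n}"
  shows "\<Phi>_poly i j k l \<in> carrier (S_alg n :: ('k::comm_ring_1, _) module)"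
  unfolding \<Phi>_poly_def by (intro carrier_S_intros assms)

lemma carrier_S_f:
  assumes "i \<in> {1..n}"
  shows "f_poly n i \<in> carrier (S_alg n :: ('k::comm_ring_1, _) module)"
  unfolding f_poly_def by (intro carrier_S_intros assms)

lemma J_gens_carrier:
  "{\<Phi>_poly i j k l | i j k l. 1 \<le> i \<and> i < j \<and> j < k \<and> k < l \<and> l \<le> n} \<union> {f_poly n i | i. 1 \<le> i \<and> i \<le> n}
    \<subseteq> carrier (S_alg n :: ('k::comm_ring_1, _) module)"
  by (auto intro!: carrier_S_Phi carrier_S_f)

lemma J_gens:
  "{\<Phi>_poly i j k l | i j k l. 1 \<le> i \<and> i < j \<and> j < k \<and> k < l \<and> l \<le> n} \<union> {f_poly n i | i. 1 \<le> i \<and> i \<le> n}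
    \<subseteq> (J_ideal n :: 'k::comm_ring_1 mpoly set)"
  unfolding J_ideal_def
  by (rule ring.genideal_self[OF cring.axioms(1)[OF cring_S] J_gens_carrier])

lemma f_in_J: "i \<in> {1..n} \<Longrightarrow> f_poly n i \<in> (J_ideal n :: 'k::comm_ring_1 mpoly set)"
  by (rule subsetD[OF J_gens]) auto

lemma x_poly_swap: "x_poly j i = - (x_poly i j :: 'k::comm_ring_1 mpoly)"
  by (auto simp: x_poly_def)

lemma x_poly_self [simp]: "x_poly i i = 0"
  by (simp add: x_poly_def)

lemma Phi_swap:
  "\<Phi>_poly j i k l = - (\<Phi>_poly i j k l :: 'k::comm_ring_1 mpoly)"
  "\<Phi>_poly i k j l = - (\<Phi>_poly i j k l :: 'k::comm_ring_1 mpoly)"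
  "\<Phi>_poly i j l k = - (\<Phi>_poly i j k l :: 'k::comm_ring_1 mpoly)"
  unfolding \<Phi>_poly_def
  by (simp_all add: x_poly_swap[of j i] x_poly_swap[of k j] x_poly_swap[of l k] algebra_simps)

lemma Phi_repeat [simp]:
  "\<Phi>_poly i i k l = 0" "\<Phi>_poly i j j l = 0" "\<Phi>_poly i j k k = 0"
  "\<Phi>_poly i j i l = 0" "\<Phi>_poly i j k j = 0" "\<Phi>_poly i j k i = 0"
  unfolding \<Phi>_poly_def
  by (simp_all add: x_poly_swap[of j i] x_poly_swap[of k i] x_poly_swap[of k j] algebra_simps)

text \<open>Phi is alternating, so up to sign it is a sorted generator or 0. The proof drops the
  ordering of one index at a time, from the last to the first. Later relations can then be written
  without sorting their indices.\<close>

lemma Phi_in_J: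
  assumes "i \<in> {1..n}" "j \<in> {1..n}" "k \<in> {1..n}" "l \<in> {1..n}"
  shows "\<Phi>_poly i j k l \<in> (J_ideal n :: 'k::comm_ring_1 mpoly set)"
proof -
  have sorted: "\<Phi>_poly i j k l \<in> (J_ideal n :: 'k mpoly set)"
    if "i < j" "j < k" "k < l" "i \<in> {1..n}" "j \<in> {1..n}" "k \<in> {1..n}" "l \<in> {1..n}" for i j k l
    by (rule subsetD[OF J_gens], rule UnI1) (use that in auto)
  have neg: "\<Phi>_poly i j k l \<in> (J_ideal n :: 'k mpoly set)" if "- \<Phi>_poly i j k l \<in> (J_ideal n :: 'k mpoly set)" for i j k l
    using J_uminus[OF that] by simp
  have three: "\<Phi>_poly i j k l \<in> (J_ideal n :: 'k mpoly set)"
    if "i < j" "j < k" "i \<in> {1..n}" "j \<in> {1..n}" "k \<in> {1..n}" "l \<in> {1..n}" for i j k l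
  proof -
    consider "k < l" | "k = l" | "j < l" "l < k" | "j = l" | "i < l" "l < j" | "i = l" | "l < i"
      by linarith
    then show ?thesis
    proof cases
      case 3
      then show ?thesis using sorted[of i j l k] that by (subst Phi_swap(3)) (simp add: J_uminus)
    next
      case 5
      then show ?thesis using sorted[of i l j k] that
        by (subst Phi_swap(3), subst Phi_swap(2)) simp
    next
      case 7
      then show ?thesis using sorted[of l i j k] that
        by (subst Phi_swap(3), subst Phi_swap(2), subst Phi_swap(1)) (simp add: J_uminus)
    qed (use sorted that in \<open>auto simp: J_zero\<close>)
  qed
  have two: "\<Phi>_poly i j k l \<in> (J_ideal n :: 'k mpoly set)"
    if "i < j" "i \<in> {1..n}" "j \<in> {1..n}" "k \<in> {1..n}" "l \<in> {1..n}" for i j k l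
  proof -
    consider "j < k" | "j = k" | "i < k" "k < j" | "i = k" | "k < i"
      by linarith
    then show ?thesis
    proof cases
      case 3
      then show ?thesis using three[of i k j l] that by (subst Phi_swap(2)) (simp add: J_uminus)
    next
      case 5
      then show ?thesis using three[of k i j l] that
        by (subst Phi_swap(2), subst Phi_swap(1)) simp
    qed (use three that in \<open>auto simp: J_zero\<close>)
  qed
  consider "i < j" | "i = j" | "j < i"
    by linarith
  then show ?thesis
  proof cases
    case 3
    then show ?thesis using two[of j i k l] assms by (subst Phi_swap(1)) (simp add: J_uminus)
  qed (use two assms in \<open>auto simp: J_zero\<close>)
qed

lemma ideal_S_I:
  fixes K :: "'k::comm_ring_1 mpoly set"
  assumes "K \<subseteq> carrier (S_alg n)" "0 \<in> K" "\<And>p q. p \<in> K \<Longrightarrow> q \<in> K \<Longrightarrow> p + q \<in> K"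
    and mult: "\<And>a p. a \<in> carrier (S_alg n) \<Longrightarrow> p \<in> K \<Longrightarrow> a * p \<in> K"
  shows "ideal K (S_alg n)"
proof -
  interpret S: cring "S_alg n :: ('k, 'k mpoly) module"
    by (rule cring_S)
  have "\<ominus>\<^bsub>S_alg n\<^esub> p \<in> K" if "p \<in> K" for p
  proof -
    have "\<ominus>\<^bsub>S_alg n\<^esub> p = - 1 * p"
      using assms(1) that by (intro S.minus_equality) (auto simp: S_alg_simps carrier_S_uminus)
    then show ?thesis
      using mult[OF carrier_S_uminus[OF carrier_S_one] that] by simp
  qed
  then have "subgroup K (add_monoid (S_alg n))"
    using assms(1-3) by (intro S.add.subgroupI) (auto simp: S_alg_simps a_inv_def[symmetric])
  then show ?thesis
  proof (rule idealI[OF S.ring_axioms])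
    show "x \<otimes>\<^bsub>S_alg n\<^esub> a \<in> K" "a \<otimes>\<^bsub>S_alg n\<^esub> x \<in> K" if "a \<in> K" "x \<in> carrier (S_alg n)" for a x
      using mult[OF that(2,1)] by (simp_all add: S_alg_simps mult.commute)
  qed
qed

lemma J_minimal:
  assumes "ideal K (S_alg n :: ('k::comm_ring_1, 'k mpoly) module)"
    and "\<And>i j k l. i \<in> {1..n} \<Longrightarrow> j \<in> {1..n} \<Longrightarrow> k \<in> {1..n} \<Longrightarrow> l \<in> {1..n} \<Longrightarrow> \<Phi>_poly i j k l \<in> K"
    and "\<And>i. i \<in> {1..n} \<Longrightarrow> f_poly n i \<in> K"
  shows "J_ideal n \<subseteq> K"
  unfolding J_ideal_def
  by (rule ring.genideal_minimal[OF cring.axioms(1)[OF cring_S] assms(1)]) (auto intro!: assms(2,3))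

text \<open>The ideal generated by J and the indeterminates in V. The cofactors are explicit
  because, up to sign, they become the values of a derivation on indeterminates.\<close>

definition J_plus :: "nat \<Rightarrow> indet set \<Rightarrow> 'k::comm_ring_1 mpoly set" where
  "J_plus n V = {p. \<exists>c. (\<forall>v\<in>V. c v \<in> carrier (S_alg n)) \<and> p - (\<Sum>v\<in>V. c v * Var v) \<in> J_ideal n}"

lemma J_subset_J_plus: "p \<in> J_ideal n \<Longrightarrow> p \<in> J_plus n V"
  unfolding J_plus_def by (auto intro!: exI[of _ "\<lambda>_. 0"] simp: carrier_S_zero)

lemma J_plus_empty [simp]: "J_plus n {} = J_ideal n"
  by (simp add: J_plus_def)

lemma J_plus_add:
  assumes "p \<in> J_plus n V" "q \<in> J_plus n V"
  shows "p + q \<in> J_plus n V"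
proof -
  obtain c d where cd: "\<forall>v\<in>V. c v \<in> carrier (S_alg n)" "p - (\<Sum>v\<in>V. c v * Var v) \<in> J_ideal n"
    "\<forall>v\<in>V. d v \<in> carrier (S_alg n)" "q - (\<Sum>v\<in>V. d v * Var v) \<in> J_ideal n"
    using assms by (auto simp: J_plus_def)
  have "p + q - (\<Sum>v\<in>V. (c v + d v) * Var v) =
      (p - (\<Sum>v\<in>V. c v * Var v)) + (q - (\<Sum>v\<in>V. d v * Var v))"
    by (simp add: algebra_simps sum.distrib)
  then have "p + q - (\<Sum>v\<in>V. (c v + d v) * Var v) \<in> J_ideal n"
    using J_add[OF cd(2,4)] by (simp only:)
  then show ?thesis
    unfolding J_plus_def using cd(1,3)
    by (intro CollectI exI[of _ "\<lambda>v. c v + d v"]) (simp add: carrier_S_add)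
qed

lemma J_plus_mult:
  assumes "a \<in> carrier (S_alg n)" "p \<in> J_plus n V"
  shows "a * p \<in> J_plus n V"
proof -
  obtain c where c: "\<forall>v\<in>V. c v \<in> carrier (S_alg n)" "p - (\<Sum>v\<in>V. c v * Var v) \<in> J_ideal n"
    using assms by (auto simp: J_plus_def)
  have "a * p - (\<Sum>v\<in>V. (a * c v) * Var v) = a * (p - (\<Sum>v\<in>V. c v * Var v))"
    by (simp add: algebra_simps sum_distrib_left)
  then show ?thesis
    unfolding J_plus_def using c assms(1)
    by (auto intro!: exI[of _ "\<lambda>v. a * c v"] J_mult simp: carrier_S_mult)
qed

lemma J_plus_uminus: "p \<in> J_plus n V \<Longrightarrow> - p \<in> J_plus n V"
  using J_plus_mult[of "- 1" n p V] by (simp add: carrier_S_closed)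

lemma J_plus_diff: "p \<in> J_plus n V \<Longrightarrow> q \<in> J_plus n V \<Longrightarrow> p - q \<in> J_plus n V"
  using J_plus_add[of p n V "- q"] by (simp add: J_plus_uminus)

lemma J_plus_sum:
  "(\<And>i. i \<in> A \<Longrightarrow> f i \<in> J_plus n V) \<Longrightarrow> sum f A \<in> J_plus n V"
  by (induction A rule: infinite_finite_induct) (simp_all add: J_plus_add J_subset_J_plus J_zero)

lemma Var_in_J_plus:
  assumes "finite V" "v \<in> V"
  shows "Var v \<in> J_plus n V"
proof -
  have "(\<Sum>u\<in>V. (if u = v then 1 else 0) * Var u) = (\<Sum>u\<in>V. if u = v then Var u else (0 :: 'a mpoly))"
    by (intro sum.cong) auto
  then show ?thesis
    unfolding J_plus_def using assms
    by (auto intro!: exI[of _ "\<lambda>u. if u = v then 1 else 0"] simp: carrier_S_closed J_zero sum.delta)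
qed

text \<open>The surviving x_ij are those with (i, j) \<ge> (s, t) componentwise, so x_st is the
  least of them. The pairs used below are (1,2), (1,3), (1,4), (1,5) and (2,3).\<close>

definition schubert_vars :: "nat \<Rightarrow> nat \<Rightarrow> nat \<Rightarrow> indet set" where
  "schubert_vars n s t = {XVar i j | i j. 1 \<le> i \<and> i < j \<and> j \<le> n \<and> (i < s \<or> j < t)}"

lemma finite_vars_S: "finite (vars_S n)"
proof (rule finite_subset)
  show "vars_S n \<subseteq> (\<lambda>(i, j). XVar i j) ` ({..n} \<times> {..n}) \<union> YVar ` {..n}"
    by (force simp: vars_S_def)
qed simp

lemma finite_schubert_vars: "finite (schubert_vars n s t)"
  by (rule finite_subset[OF _ finite_vars_S[of n]]) (auto simp: vars_S_def schubert_vars_def)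

text \<open>The excluded products are leading terms of generators: x_il x_jk of Phi_ijkl, x_in y_n
  of f_i for i < n, and x_(n-1)n y_(n-1) of f_n, in which y_n does not occur.\<close>

definition standard :: "nat \<Rightarrow> nat \<Rightarrow> nat \<Rightarrow> (indet \<Rightarrow>\<^sub>0 nat) \<Rightarrow> bool" where
  "standard n s t m \<longleftrightarrow> Poly_Mapping.keys m \<subseteq> vars_S n - schubert_vars n s t \<and>
    (\<forall>i j k l. i < j \<longrightarrow> j < k \<longrightarrow> k < l \<longrightarrow> XVar i l \<in> Poly_Mapping.keys m \<longrightarrow> XVar j k \<notin> Poly_Mapping.keys m) \<and>
    (\<forall>i. XVar i n \<in> Poly_Mapping.keys m \<longrightarrow> YVar n \<notin> Poly_Mapping.keys m) \<and>
    (XVar (n - 1) n \<in> Poly_Mapping.keys m \<longrightarrow> YVar (n - 1) \<notin> Poly_Mapping.keys m)"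

text \<open>
  Under this weight every non-standard product of two indeterminates is heavier than the other
  terms of the generator of \<open>J_ideal n\<close> that contains it.
\<close>

definition straight_wt :: "nat \<Rightarrow> indet \<Rightarrow> nat" where
  "straight_wt n v = (case v of XVar i j \<Rightarrow> (j - i)\<^sup>2 | YVar j \<Rightarrow> n\<^sup>2 * j)"

section \<open>Reduction of non-standard monomials\<close>

lemma wdeg_less_Var: "wdeg_less wt w (Var v :: 'k::comm_ring_1 mpoly) \<longleftrightarrow> wt v < w"
  by (simp add: Var_def wdeg_less_single)

lemma wdeg_less_x: "i \<le> j \<Longrightarrow> wdeg_less (straight_wt n) (Suc ((j - i)\<^sup>2)) (x_poly i j :: 'k::comm_ring_1 mpoly)"
  by (auto simp: x_poly_def wdeg_less_Var straight_wt_def)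

lemma wdeg_less_x': "i \<le> j \<Longrightarrow> wdeg_less (straight_wt n) (Suc ((j - i)\<^sup>2)) (x_poly j i :: 'k::comm_ring_1 mpoly)"
  using wdeg_less_x[of i j n] by (simp add: x_poly_swap[of j i])

text \<open>A reduction of the factor d to g is multiplied by the cofactor m; weights add, so the
  result is lighter than m + d.\<close>

lemma straightening_step:
  fixes g :: "'k::comm_ring_1 mpoly"
  assumes m: "Poly_Mapping.keys (m + d) \<subseteq> vars_S n"
    and g: "g \<in> carrier (S_alg n)" "wdeg_less (straight_wt n) (wdeg (straight_wt n) d) g"
    and J: "Poly_Mapping.single d 1 - g \<in> J_plus n V"
  shows "\<exists>q. q \<in> carrier (S_alg n) \<and> wdeg_less (straight_wt n) (wdeg (straight_wt n) (m + d)) q \<and>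
    Poly_Mapping.single (m + d) (1 :: 'k) - q \<in> J_plus n V"
proof (intro exI conjI)
  have "Poly_Mapping.keys m \<subseteq> Poly_Mapping.keys (m + d)"
    by (auto simp: in_keys_iff Poly_Mapping.lookup_add)
  then have mc: "Poly_Mapping.single m (1 :: 'k) \<in> carrier (S_alg n)"
    using m by (auto simp: S_alg_def)
  show "Poly_Mapping.single m 1 * g \<in> carrier (S_alg n)"
    using mc g(1) by (rule carrier_S_mult)
  show "wdeg_less (straight_wt n) (wdeg (straight_wt n) (m + d)) (Poly_Mapping.single m 1 * g)"
    unfolding wdeg_add using g(2) by (intro wdeg_less_mult) (simp_all add: wdeg_less_single)
  have "Poly_Mapping.single (m + d) 1 - Poly_Mapping.single m 1 * g = Poly_Mapping.single m 1 * (Poly_Mapping.single d 1 - g)"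
    by (simp add: right_diff_distrib Poly_Mapping.mult_single)
  then show "Poly_Mapping.single (m + d) (1 :: 'k) - Poly_Mapping.single m 1 * g \<in> J_plus n V"
    using J_plus_mult[OF mc J] by simp
qed

lemma split_key:
  fixes m :: "'v \<Rightarrow>\<^sub>0 nat"
  assumes "v \<in> Poly_Mapping.keys m"
  obtains m' where "m = m' + Poly_Mapping.single v 1"
proof
  show "m = (m - Poly_Mapping.single v 1) + Poly_Mapping.single v 1"
    using assms by (intro poly_mapping_eqI)
      (auto simp: Poly_Mapping.lookup_add Poly_Mapping.lookup_minus Poly_Mapping.lookup_single
        in_keys_iff when_def)
qed

lemma split_two_keys:
  fixes m :: "'v \<Rightarrow>\<^sub>0 nat"
  assumes "v \<in> Poly_Mapping.keys m" "w \<in> Poly_Mapping.keys m" "v \<noteq> w"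
  obtains m' where "m = m' + (Poly_Mapping.single v 1 + Poly_Mapping.single w 1)"
proof -
  obtain m1 where m1: "m = m1 + Poly_Mapping.single v 1"
    using split_key[OF assms(1)] .
  then have "w \<in> Poly_Mapping.keys m1"
    using assms(2,3) by (auto simp: in_keys_iff Poly_Mapping.lookup_add Poly_Mapping.lookup_single when_def)
  then show ?thesis
    using that m1 by (metis split_key add.assoc add.commute)
qed

lemma Var_mult: "Var v * Var w = Poly_Mapping.single (Poly_Mapping.single v 1 + Poly_Mapping.single w 1) (1 :: 'k::comm_ring_1)"
  by (simp add: Var_def Poly_Mapping.mult_single)

lemma sum_last_two:
  fixes f :: "nat \<Rightarrow> 'a::comm_monoid_add"
  assumes "2 \<le> n"
  shows "sum f {1..n} = f n + (f (n - 1) + sum f {1..n - 2})"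
proof -
  obtain k where "n = Suc (Suc k)"
    using assms by (metis Suc_le_D numeral_2_eq_2 Suc_le_mono)
  then show ?thesis
    by (simp add: add_ac)
qed

lemma square_diff_nat_less: "j < n \<Longrightarrow> (j - i :: nat)\<^sup>2 < n\<^sup>2"
  by (rule power_strict_mono) auto

lemma straightening:
  assumes n: "2 \<le> n" and m: "Poly_Mapping.keys m \<subseteq> vars_S n" "\<not> standard n s t m"
  shows "\<exists>q. q \<in> carrier (S_alg n) \<and> wdeg_less (straight_wt n) (wdeg (straight_wt n) m) q \<and>
    Poly_Mapping.single m (1 :: 'k::comm_ring_1) - q \<in> J_plus n (schubert_vars n s t)"
proof -
  let ?P = "\<lambda>m. \<exists>q. q \<in> carrier (S_alg n) \<and> wdeg_less (straight_wt n) (wdeg (straight_wt n) m) q \<and>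
    Poly_Mapping.single m (1 :: 'k) - q \<in> J_plus n (schubert_vars n s t)"
  have Xv: "1 \<le> i \<and> i < j \<and> j \<le> n" if "XVar i j \<in> Poly_Mapping.keys m" for i j
    using that m(1) by (auto simp: vars_S_def)
  consider v where "v \<in> Poly_Mapping.keys m" "v \<in> schubert_vars n s t"
    | i j k l where "i < j" "j < k" "k < l" "XVar i l \<in> Poly_Mapping.keys m" "XVar j k \<in> Poly_Mapping.keys m"
    | i where "XVar i n \<in> Poly_Mapping.keys m" "YVar n \<in> Poly_Mapping.keys m"
    | "XVar (n - 1) n \<in> Poly_Mapping.keys m" "YVar (n - 1) \<in> Poly_Mapping.keys m"
    using m unfolding standard_def by blast
  then show ?thesis
  proof cases
    case 1
    obtain m' where m': "m = m' + Poly_Mapping.single v 1"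
      by (rule split_key[OF 1(1)])
    show ?thesis
      unfolding m'
      using m(1) m' Var_in_J_plus[OF finite_schubert_vars 1(2)]
      by (intro straightening_step[where g = 0]) (simp_all add: carrier_S_zero Var_def)
  next
    case 2
    define d where "d = Poly_Mapping.single (XVar i l) (1::nat) + Poly_Mapping.single (XVar j k) 1"
    obtain m' where m': "m = m' + d"
      using split_two_keys[of "XVar i l" m "XVar j k"] 2 unfolding d_def by auto
    have b: "i \<in> {1..n}" "j \<in> {1..n}" "k \<in> {1..n}" "l \<in> {1..n}"
      using Xv[OF 2(4)] Xv[OF 2(5)] 2 by auto
    \<comment> \<open>In terms of the gaps, x_il x_jk has weight (a+b+c)^2 + b^2, x_ik x_jl has
      (a+b)^2 + (b+c)^2, and x_ij x_kl has a^2 + c^2. The first exceeds the second by 2ac, which is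
      positive.\<close>
    define a b c where "a = j - i" and "b = k - j" and "c = l - k"
    have abc: "j = i + a" "k = i + a + b" "l = i + a + b + c" "0 < a" "0 < c"
      using 2 by (auto simp: a_def b_def c_def)
    have ac: "Suc 0 \<le> a * c"
      using abc(4,5) by simp
    have sq: "(a + b)\<^sup>2 = a\<^sup>2 + 2 * (a * b) + b\<^sup>2" "(b + c)\<^sup>2 = b\<^sup>2 + 2 * (b * c) + c\<^sup>2"
      "(a + b + c)\<^sup>2 = a\<^sup>2 + b\<^sup>2 + c\<^sup>2 + 2 * (a * b) + 2 * (b * c) + 2 * (a * c)"
      by (simp_all add: power2_eq_square algebra_simps)
    have wd: "wdeg (straight_wt n) d = (a + b + c)\<^sup>2 + b\<^sup>2"
      by (simp add: d_def wdeg_add straight_wt_def abc)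
    let ?g = "x_poly i k * x_poly j l - x_poly i j * x_poly k l :: 'k mpoly"
    have "wdeg_less (straight_wt n) ((a + b)\<^sup>2 + Suc ((b + c)\<^sup>2)) (x_poly i k * x_poly j l :: 'k mpoly)"
      by (rule wdeg_less_mult) (use wdeg_less_x[of i k n] wdeg_less_x[of j l n] abc in auto)
    moreover have "(a + b)\<^sup>2 + Suc ((b + c)\<^sup>2) \<le> (a + b + c)\<^sup>2 + b\<^sup>2"
      using ac unfolding sq by linarith
    moreover have "wdeg_less (straight_wt n) (a\<^sup>2 + Suc (c\<^sup>2)) (x_poly i j * x_poly k l :: 'k mpoly)"
      by (rule wdeg_less_mult) (use wdeg_less_x[of i j n] wdeg_less_x[of k l n] abc in auto)
    moreover have "a\<^sup>2 + Suc (c\<^sup>2) \<le> (a + b + c)\<^sup>2 + b\<^sup>2"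
      using ac unfolding sq by linarith
    ultimately have "wdeg_less (straight_wt n) (wdeg (straight_wt n) d) ?g"
      unfolding wd by (intro wdeg_less_diff) (blast intro: wdeg_less_mono)+
    moreover have "Poly_Mapping.single d 1 - ?g = \<Phi>_poly i j k l"
      using 2 by (simp add: d_def \<Phi>_poly_def x_poly_def Var_mult)
    ultimately show ?thesis
      unfolding m' using m m' b Phi_in_J[of i n j k l]
      by (intro straightening_step[where g = ?g])
        (auto intro!: carrier_S_diff carrier_S_mult carrier_S_x J_subset_J_plus)
  next
    case 3
    define d where "d = Poly_Mapping.single (XVar i n) (1::nat) + Poly_Mapping.single (YVar n) 1"
    obtain m' where m': "m = m' + d"
      using split_two_keys[of "XVar i n" m "YVar n"] 3 unfolding d_def by auto
    have i: "1 \<le> i" "i < n"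
      using Xv[OF 3(1)] by auto
    have wd: "wdeg (straight_wt n) d = (n - i)\<^sup>2 + n\<^sup>2 * n"
      by (simp add: d_def wdeg_add straight_wt_def)
    let ?g = "- (\<Sum>j=1..n-1. x_poly i j * y_poly j) :: 'k mpoly"
    have "wdeg_less (straight_wt n) (wdeg (straight_wt n) d) (x_poly i j * y_poly j :: 'k mpoly)" if j: "j \<in> {1..n-1}" for j
    proof (rule wdeg_less_mono)
      \<comment> \<open>One of the two truncated differences is 0, so the sum is the squared
        distance of i and j. It is below n^2, the worth of one step in the index of y, hence the
        largest y index decides which term dominates.\<close>
      have "wdeg_less (straight_wt n) (Suc ((j - i)\<^sup>2 + (i - j)\<^sup>2)) (x_poly i j :: 'k mpoly)"
        using wdeg_less_x[of i j n] wdeg_less_x'[of j i n] by (cases "i \<le> j") auto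
      then show "wdeg_less (straight_wt n) ((j - i)\<^sup>2 + (i - j)\<^sup>2 + Suc (n\<^sup>2 * j)) (x_poly i j * y_poly j :: 'k mpoly)"
        by (rule wdeg_less_mult) (simp add: y_poly_def wdeg_less_Var straight_wt_def)
      have "(j - i)\<^sup>2 + (i - j)\<^sup>2 < n\<^sup>2"
        using square_diff_nat_less[of j n i] square_diff_nat_less[of i n j] i j by (cases "i \<le> j") auto
      then have "(j - i)\<^sup>2 + (i - j)\<^sup>2 + Suc (n\<^sup>2 * j) \<le> n\<^sup>2 * Suc j"
        by simp
      also have "\<dots> \<le> n\<^sup>2 * n"
        using j by (intro mult_le_mono2) auto
      finally show "(j - i)\<^sup>2 + (i - j)\<^sup>2 + Suc (n\<^sup>2 * j) \<le> wdeg (straight_wt n) d"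
        unfolding wd by simp
    qed
    then have "wdeg_less (straight_wt n) (wdeg (straight_wt n) d) ?g"
      unfolding wdeg_less_uminus by (rule wdeg_less_sum)
    moreover have "Poly_Mapping.single d 1 - ?g = f_poly n i"
    proof -
      have "{1..n} = insert n {1..n-1}"
        using n by auto
      then have "f_poly n i = x_poly i n * y_poly n - (?g :: 'k mpoly)"
        using n by (simp add: f_poly_def)
      then show ?thesis
        using i by (simp add: d_def x_poly_def y_poly_def Var_mult)
    qed
    ultimately show ?thesis
      unfolding m' using m m' i f_in_J[of i n]
      by (intro straightening_step[where g = ?g])
        (auto intro!: carrier_S_uminus carrier_S_sum carrier_S_mult carrier_S_x carrier_S_y J_subset_J_plus)
  next
    case 4
    define d where "d = Poly_Mapping.single (XVar (n - 1) n) (1::nat) + Poly_Mapping.single (YVar (n - 1)) 1"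
    obtain m' where m': "m = m' + d"
      using split_two_keys[of "XVar (n - 1) n" m "YVar (n - 1)"] 4 unfolding d_def by auto
    have wd: "wdeg (straight_wt n) d = (n - (n - 1))\<^sup>2 + n\<^sup>2 * (n - 1)"
      by (simp add: d_def wdeg_add straight_wt_def)
    \<comment> \<open>As x_nn = 0, the dominant term of f_n is the one with y_(n-1). The generator
      is used with the opposite sign because x_nj = - x_jn.\<close>
    let ?g = "- (\<Sum>j=1..n-2. x_poly j n * y_poly j) :: 'k mpoly"
    have "wdeg_less (straight_wt n) (wdeg (straight_wt n) d) (x_poly j n * y_poly j :: 'k mpoly)" if j: "j \<in> {1..n-2}" for j
    proof (rule wdeg_less_mono)
      show "wdeg_less (straight_wt n) ((n - j)\<^sup>2 + Suc (n\<^sup>2 * j)) (x_poly j n * y_poly j :: 'k mpoly)"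
        using j by (intro wdeg_less_mult wdeg_less_x) (auto simp: y_poly_def wdeg_less_Var straight_wt_def)
      have "(n - j)\<^sup>2 < n\<^sup>2"
        using j by (intro power_strict_mono) auto
      then have "(n - j)\<^sup>2 + Suc (n\<^sup>2 * j) \<le> n\<^sup>2 * Suc j"
        by simp
      also have "\<dots> \<le> n\<^sup>2 * (n - 1)"
        using j by (intro mult_le_mono2) auto
      finally show "(n - j)\<^sup>2 + Suc (n\<^sup>2 * j) \<le> wdeg (straight_wt n) d"
        unfolding wd by simp
    qed
    then have "wdeg_less (straight_wt n) (wdeg (straight_wt n) d) ?g"
      unfolding wdeg_less_uminus by (rule wdeg_less_sum)
    moreover have "Poly_Mapping.single d 1 - ?g = - f_poly n n"
    proof -
      have "f_poly n n = x_poly n (n - 1) * y_poly (n - 1) + (\<Sum>j=1..n-2. x_poly n j * y_poly j :: 'k mpoly)"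
        unfolding f_poly_def sum_last_two[OF n] by simp
      also have "(\<Sum>j=1..n-2. x_poly n j * y_poly j) = (?g :: 'k mpoly)"
        by (simp add: x_poly_swap[of n] sum_negf)
      also have "x_poly n (n - 1) = - (Var (XVar (n - 1) n) :: 'k mpoly)"
        using n by (auto simp: x_poly_def)
      finally show ?thesis
        by (simp add: d_def y_poly_def Var_mult)
    qed
    ultimately show ?thesis
      unfolding m' using m m' n f_in_J[of n n]
      by (intro straightening_step[where g = ?g])
        (auto intro!: carrier_S_uminus carrier_S_sum carrier_S_mult carrier_S_x carrier_S_y J_subset_J_plus J_uminus)
  qed
qed

text \<open>Induction on a strict weight bound: straightening replaces a non-standard monomial by a
  polynomial below its own weight, to which the induction hypothesis applies.\<close>

lemma standard_spanning:
  fixes p :: "'k::comm_ring_1 mpoly"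
  assumes n: "2 \<le> n" and p: "p \<in> carrier (S_alg n)"
  obtains q where "\<forall>m\<in>Poly_Mapping.keys q. standard n s t m" "p - q \<in> J_plus n (schubert_vars n s t)"
proof -
  let ?V = "schubert_vars n s t"
  have "\<exists>q. (\<forall>m\<in>Poly_Mapping.keys q. standard n s t m) \<and> p - q \<in> J_plus n ?V"
    if "wdeg_less (straight_wt n) w p" "p \<in> carrier (S_alg n)" for w and p :: "'k mpoly"
    using that
  proof (induction w arbitrary: p rule: less_induct)
    case (less w)
    have "\<exists>q. (\<forall>m\<in>Poly_Mapping.keys q. standard n s t m) \<and> Poly_Mapping.single m (1 :: 'k) - q \<in> J_plus n ?V"
      if m: "m \<in> Poly_Mapping.keys p" for m
    proof (cases "standard n s t m")
      case True
      then show ?thesis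
        by (intro exI[of _ "Poly_Mapping.single m 1"]) (auto simp: J_subset_J_plus J_zero)
    next
      case False
      have "Poly_Mapping.keys m \<subseteq> vars_S n" "wdeg (straight_wt n) m < w"
        using less.prems m by (auto simp: S_alg_def wdeg_less_def)
      then obtain q where q: "q \<in> carrier (S_alg n)" "wdeg_less (straight_wt n) (wdeg (straight_wt n) m) q"
        "Poly_Mapping.single m (1 :: 'k) - q \<in> J_plus n ?V"
        using straightening[OF n _ False] by blast
      then obtain q' where "\<forall>m\<in>Poly_Mapping.keys q'. standard n s t m" "q - q' \<in> J_plus n ?V"
        using less.IH[of "wdeg (straight_wt n) m" q] \<open>wdeg (straight_wt n) m < w\<close> by blast
      then show ?thesis
        using J_plus_add[OF q(3), of "q - q'"] by auto
    qed
    then obtain Q where Q: "\<And>m m'. m \<in> Poly_Mapping.keys p \<Longrightarrow> m' \<in> Poly_Mapping.keys (Q m) \<Longrightarrow> standard n s t m'"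
      "\<And>m. m \<in> Poly_Mapping.keys p \<Longrightarrow> Poly_Mapping.single m (1 :: 'k) - Q m \<in> J_plus n ?V"
      by metis
    let ?q = "\<Sum>m\<in>Poly_Mapping.keys p. Poly_Mapping.single 0 (Poly_Mapping.lookup p m) * Q m"
    have "p - ?q = (\<Sum>m\<in>Poly_Mapping.keys p. Poly_Mapping.single m (Poly_Mapping.lookup p m)) - ?q"
      by (simp flip: poly_mapping_eq_sum_single)
    also have "\<dots> = (\<Sum>m\<in>Poly_Mapping.keys p. Poly_Mapping.single 0 (Poly_Mapping.lookup p m) * (Poly_Mapping.single m 1 - Q m))"
      by (simp add: right_diff_distrib sum_subtractf Poly_Mapping.mult_single)
    also have "\<dots> \<in> J_plus n ?V"
      using Q(2) by (intro J_plus_sum J_plus_mult carrier_S_const)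
    finally have "p - ?q \<in> J_plus n ?V" .
    moreover have "standard n s t m'" if m': "m' \<in> Poly_Mapping.keys ?q" for m'
    proof -
      obtain m where m: "m \<in> Poly_Mapping.keys p"
        "m' \<in> Poly_Mapping.keys (Poly_Mapping.single 0 (Poly_Mapping.lookup p m) * Q m)"
        using subsetD[OF Poly_Mapping.keys_sum m'] by blast
      then have "m' \<in> Poly_Mapping.keys (Q m)"
        using Poly_Mapping.keys_mult[of "Poly_Mapping.single 0 (Poly_Mapping.lookup p m)" "Q m"]
        by (auto split: if_splits)
      then show ?thesis
        using Q(1) m(1) by blast
    qed
    ultimately show ?case by blast
  qed
  moreover have "wdeg_less (straight_wt n) (Suc (Max (wdeg (straight_wt n) ` Poly_Mapping.keys p))) p"
    by (auto simp: wdeg_less_def less_Suc_eq_le)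
  ultimately show thesis
    using p that by blast
qed

section \<open>Linear independence of standard monomials\<close>

lemma sum_chain_rectangle:
  fixes e :: "nat \<Rightarrow> nat \<Rightarrow> nat"
  assumes chain: "\<And>i j k l. i < k \<Longrightarrow> l < j \<Longrightarrow> e i j = 0 \<or> e k l = 0"
    and ab: "a \<le> N" "b \<le> N"
  shows "(\<Sum>i<a. \<Sum>j<b. e i j) = min (\<Sum>i<a. \<Sum>j<N. e i j) (\<Sum>j<b. \<Sum>i<N. e i j)"
proof -
  have split: "(\<Sum>j<N. f j) = (\<Sum>j<c. f j) + (\<Sum>j=c..<N. f j)" if "c \<le> N" for c and f :: "nat \<Rightarrow> nat"
    using that by (simp add: lessThan_atLeast0 sum.atLeastLessThan_concat)
  define A where "A = (\<Sum>i<a. \<Sum>j=b..<N. e i j)"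
  define B where "B = (\<Sum>j<b. \<Sum>i=a..<N. e i j)"
  have rows: "(\<Sum>i<a. \<Sum>j<N. e i j) = (\<Sum>i<a. \<Sum>j<b. e i j) + A"
    unfolding A_def using split[OF ab(2)] by (simp add: sum.distrib)
  have cols: "(\<Sum>j<b. \<Sum>i<N. e i j) = (\<Sum>i<a. \<Sum>j<b. e i j) + B"
    unfolding B_def using split[OF ab(1)] by (simp add: sum.distrib sum.swap[of _ "{..<a}"])
  \<comment> \<open>A collects entries with i < a and b \<le> j, B those with a \<le> i and j < b. A
    nonzero entry of the one kind and a nonzero entry of the other are incomparable, which a chain
    forbids. So one of the two margins equals the corner sum and is the minimum.\<close>
  have "A = 0 \<or> B = 0"
  proof (rule ccontr)
    assume "\<not> (A = 0 \<or> B = 0)"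
    then obtain i j k l where "i < a" "b \<le> j" "e i j \<noteq> 0" "l < b" "a \<le> k" "e k l \<noteq> 0"
      unfolding A_def B_def by (auto simp: sum_eq_0_iff)
    then show False
      using chain[of i k l j] by simp
  qed
  then show ?thesis
    unfolding rows cols by auto
qed

text \<open>Corner sums are determined by the margins, and an entry is a second difference of corner
  sums. This is the uniqueness behind the northwest corner rule.\<close>

lemma chain_eqI:
  fixes e e' :: "nat \<Rightarrow> nat \<Rightarrow> nat"
  assumes "\<And>i j k l. i < k \<Longrightarrow> l < j \<Longrightarrow> e i j = 0 \<or> e k l = 0"
    and "\<And>i j k l. i < k \<Longrightarrow> l < j \<Longrightarrow> e' i j = 0 \<or> e' k l = 0"
    and "\<And>i. i < N \<Longrightarrow> (\<Sum>j<N. e i j) = (\<Sum>j<N. e' i j)"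
    and "\<And>j. j < N \<Longrightarrow> (\<Sum>i<N. e i j) = (\<Sum>i<N. e' i j)"
    and ij: "i < N" "j < N"
  shows "e i j = e' i j"
proof -
  have *: "(\<Sum>i<a. \<Sum>j<b. e i j) = (\<Sum>i<a. \<Sum>j<b. e' i j)" if "a \<le> N" "b \<le> N" for a b
    using assms that by (simp add: sum_chain_rectangle[of e a N b] sum_chain_rectangle[of e' a N b])
  have **: "(\<Sum>j<b. e i j) = (\<Sum>j<b. e' i j)" if "b \<le> N" for b
    using *[of "Suc i" b] *[of i b] ij that by simp
  show ?thesis
    using **[of "Suc j"] **[of j] ij by simp
qed

section \<open>Parametrised points of a Schubert variety\<close>

datatype param = RPar nat | SPar nat | TPar nat

definition mvar :: "'v \<Rightarrow> ('v \<Rightarrow>\<^sub>0 nat) \<Rightarrow>\<^sub>0 'k::comm_ring_1" where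
  "mvar v = Poly_Mapping.single (Poly_Mapping.single v 1) 1"

text \<open>
  Generic point of the Schubert variety: the plane is spanned by the rows \<open>r\<close> and \<open>s\<close>, where
  \<open>r\<^sub>i = 0\<close> for \<open>i < s\<close> and \<open>s\<^sub>i = 0\<close> for \<open>i < t\<close>. The vector \<open>y\<close> is the solution of
  \<open>X y = 0\<close> with free entries \<open>y\<^sub>1, \<dots>, y\<^sub>n\<^sub>-\<^sub>2\<close>, scaled by the minor \<open>x\<^sub>n\<^sub>-\<^sub>1\<^sub>,\<^sub>n\<close> to clear denominators.
\<close>

definition x_param :: "nat \<Rightarrow> nat \<Rightarrow> nat \<Rightarrow> nat \<Rightarrow> (param \<Rightarrow>\<^sub>0 nat) \<Rightarrow>\<^sub>0 'k::comm_ring_1" where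
  "x_param s t i j = (if i < s \<or> j < t then 0 else mvar (RPar i) * mvar (SPar j)) -
    (if j < s \<or> i < t then 0 else mvar (RPar j) * mvar (SPar i))"

definition y_param :: "nat \<Rightarrow> nat \<Rightarrow> nat \<Rightarrow> nat \<Rightarrow> (param \<Rightarrow>\<^sub>0 nat) \<Rightarrow>\<^sub>0 'k::comm_ring_1" where
  "y_param n s t j =
    (if j = n then \<Sum>k=1..n-2. x_param s t k (n - 1) * mvar (TPar k)
     else if j = n - 1 then - (\<Sum>k=1..n-2. x_param s t k n * mvar (TPar k))
     else x_param s t (n - 1) n * mvar (TPar j))"

definition var_param :: "nat \<Rightarrow> nat \<Rightarrow> nat \<Rightarrow> indet \<Rightarrow> (param \<Rightarrow>\<^sub>0 nat) \<Rightarrow>\<^sub>0 'k::comm_ring_1" where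
  "var_param n s t v = (case v of XVar i j \<Rightarrow> x_param s t i j | YVar j \<Rightarrow> y_param n s t j)"

abbreviation param_hom :: "nat \<Rightarrow> nat \<Rightarrow> nat \<Rightarrow> 'k::comm_ring_1 mpoly \<Rightarrow> (param \<Rightarrow>\<^sub>0 nat) \<Rightarrow>\<^sub>0 'k" where
  "param_hom n s t \<equiv> mpoly_subst (Poly_Mapping.single 0) (var_param n s t)"

interpretation param: coeff_hom "Poly_Mapping.single (0 :: param \<Rightarrow>\<^sub>0 nat) :: 'k::comm_ring_1 \<Rightarrow> _"
  by (rule coeff_hom_single)

lemma param_hom_Var: "param_hom n s t (Var v) = var_param n s t v"
  by (simp add: Var_def)

lemma param_hom_x: "param_hom n s t (x_poly i j :: 'k::comm_ring_1 mpoly) = x_param s t i j"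
  by (auto simp: x_poly_def param_hom_Var param.mpoly_subst_uminus var_param_def x_param_def)

lemma param_hom_y: "param_hom n s t (y_poly j :: 'k::comm_ring_1 mpoly) = y_param n s t j"
  by (simp add: y_poly_def param_hom_Var var_param_def)

text \<open>A 2 x 2 minor of two rows that absorb the truncations, so that the Pluecker identity
  applies without a case distinction.\<close>

lemma x_param_eq:
  "x_param s t i j = (if i < s then 0 else mvar (RPar i)) * (if j < t then 0 else mvar (SPar j)) -
    (if j < s then 0 else mvar (RPar j)) * (if i < t then 0 else mvar (SPar i))"
  by (simp add: x_param_def)

lemma plucker_minors:
  fixes r r' :: "nat \<Rightarrow> 'a::comm_ring_1"
  shows "(r i * r' j - r j * r' i) * (r k * r' l - r l * r' k) - (r i * r' k - r k * r' i) * (r j * r' l - r l * r' j) +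
    (r i * r' l - r l * r' i) * (r j * r' k - r k * r' j) = 0"
  by (simp add: algebra_simps)

lemma plucker_x_param:
  "x_param s t i j * x_param s t k l - x_param s t i k * x_param s t j l + x_param s t i l * x_param s t j k = 0"
  unfolding x_param_eq by (rule plucker_minors)

text \<open>The coefficient of the parameter T_k in the image of f_i is the Pluecker relation for
  the indices i, k, n - 1, n.\<close>

lemma param_hom_f:
  assumes "2 \<le> n"
  shows "param_hom n s t (f_poly n i :: 'k::comm_ring_1 mpoly) = 0"
proof -
  let ?X = "x_param s t :: nat \<Rightarrow> nat \<Rightarrow> (param \<Rightarrow>\<^sub>0 nat) \<Rightarrow>\<^sub>0 'k"
  have "param_hom n s t (f_poly n i :: 'k mpoly) = (\<Sum>j=1..n. ?X i j * y_param n s t j)"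
    by (simp add: f_poly_def param.mpoly_subst_hom param_hom_x param_hom_y)
  also have "\<dots> = ?X i n * (\<Sum>k=1..n-2. ?X k (n - 1) * mvar (TPar k)) +
      (?X i (n - 1) * - (\<Sum>k=1..n-2. ?X k n * mvar (TPar k)) +
       (\<Sum>j=1..n-2. ?X i j * (?X (n - 1) n * mvar (TPar j))))"
    unfolding sum_last_two[OF assms] using assms
    by (intro arg_cong2[where f = plus] sum.cong refl) (auto simp: y_param_def)
  also have "\<dots> = (\<Sum>k=1..n-2. (?X i n * ?X k (n - 1) - ?X i (n - 1) * ?X k n + ?X i k * ?X (n - 1) n) * mvar (TPar k))"
    by (simp add: sum_distrib_left sum.distrib sum_subtractf algebra_simps)
  also have "\<dots> = 0"
  proof (intro sum.neutral ballI)
    fix k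
    have "?X i n * ?X k (n - 1) - ?X i (n - 1) * ?X k n + ?X i k * ?X (n - 1) n = 0"
      using plucker_x_param[of s t i k "n - 1" n, where 'a = 'k] by (simp add: algebra_simps)
    then show "(?X i n * ?X k (n - 1) - ?X i (n - 1) * ?X k n + ?X i k * ?X (n - 1) n) * mvar (TPar k) = 0"
      by simp
  qed
  finally show ?thesis .
qed

lemma param_hom_J:
  assumes n: "2 \<le> n" and p: "p \<in> J_ideal n"
  shows "param_hom n s t (p :: 'k::comm_ring_1 mpoly) = 0"
proof -
  let ?K = "{p \<in> carrier (S_alg n). param_hom n s t (p :: 'k mpoly) = 0}"
  have K: "ideal ?K (S_alg n)"
    by (rule ideal_S_I) (auto simp: carrier_S_closed param.mpoly_subst_hom)
  have Phi: "param_hom n s t (\<Phi>_poly i j k l :: 'k mpoly) = 0" for i j k l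
    by (simp add: \<Phi>_poly_def param.mpoly_subst_hom param_hom_x plucker_x_param)
  have "J_ideal n \<subseteq> ?K"
    by (rule J_minimal[OF K]) (auto simp: Phi param_hom_f[OF n] intro!: carrier_S_Phi carrier_S_f)
  then show ?thesis
    using p by blast
qed

lemma param_hom_J_plus:
  assumes n: "2 \<le> n" "s < t" and p: "p \<in> J_plus n (schubert_vars n s t)"
  shows "param_hom n s t (p :: 'k::comm_ring_1 mpoly) = 0"
proof -
  obtain c where "p - (\<Sum>v\<in>schubert_vars n s t. c v * Var v) \<in> J_ideal n"
    using p by (auto simp: J_plus_def)
  then have "param_hom n s t p = (\<Sum>v\<in>schubert_vars n s t. param_hom n s t (c v) * var_param n s t v)"
    using param_hom_J[OF n(1), of "p - (\<Sum>v\<in>schubert_vars n s t. c v * Var v)" s t]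
    by (simp add: param.mpoly_subst_hom param_hom_Var)
  \<comment> \<open>The second product of the minor vanishes together with the first: for i < j,
    each of i < s and j < t implies i < t, because s < t.\<close>
  also have "\<dots> = 0"
    using n(2) by (intro sum.neutral) (auto simp: schubert_vars_def var_param_def x_param_def)
  finally show ?thesis .
qed

section \<open>Leading monomials of the parametrisation\<close>

definition param_wt :: "nat \<Rightarrow> param \<Rightarrow> nat" where
  "param_wt s v = (case v of RPar i \<Rightarrow> 0 | SPar j \<Rightarrow> j | TPar j \<Rightarrow> if j = s then 1 else 0)"

text \<open>Since S_j has weight j, the product r_i s_j leads the minor x_ij for i < j. In the sums
  for y_n and y_(n-1) the leading products r_k s_j share the index j and would tie; weight 1 on T_s
  singles out k = s.\<close>

definition lead_param :: "nat \<Rightarrow> nat \<Rightarrow> indet \<Rightarrow> param \<Rightarrow>\<^sub>0 nat" where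
  "lead_param n s v = (case v of
     XVar i j \<Rightarrow> Poly_Mapping.single (RPar i) 1 + Poly_Mapping.single (SPar j) 1
   | YVar j \<Rightarrow>
      (if j = n then Poly_Mapping.single (RPar s) 1 + Poly_Mapping.single (SPar (n - 1)) 1 + Poly_Mapping.single (TPar s) 1
       else if j = n - 1 then Poly_Mapping.single (RPar s) 1 + Poly_Mapping.single (SPar n) 1 + Poly_Mapping.single (TPar s) 1
       else Poly_Mapping.single (RPar (n - 1)) 1 + Poly_Mapping.single (SPar n) 1 + Poly_Mapping.single (TPar j) 1))"

lemma leads_mvar: "leads wt (mvar v :: ('v \<Rightarrow>\<^sub>0 nat) \<Rightarrow>\<^sub>0 'k::idom) (Poly_Mapping.single v 1)"
  unfolding leads_def by (rule exI[of _ 1]) (simp add: mvar_def)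

lemma leads_add_less:
  assumes "leads wt p a" "wdeg_less wt (wdeg wt a) q"
  shows "leads wt (p + q) a"
proof -
  obtain c where "c \<noteq> 0" "wdeg_less wt (wdeg wt a) (p - Poly_Mapping.single a c)"
    using assms(1) by (auto simp: leads_def)
  moreover have "p + q - Poly_Mapping.single a c = (p - Poly_Mapping.single a c) + q"
    by simp
  ultimately show ?thesis
    unfolding leads_def using assms(2) by (metis wdeg_less_add)
qed

lemma leads_uminus:
  assumes "leads wt p a"
  shows "leads wt (- p) a"
proof -
  obtain c where c: "c \<noteq> 0" "wdeg_less wt (wdeg wt a) (p - Poly_Mapping.single a c)"
    using assms by (auto simp: leads_def)
  have "- p - Poly_Mapping.single a (- c) = - (p - Poly_Mapping.single a c)"
    by (simp add: Poly_Mapping.single_uminus)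
  then have "wdeg_less wt (wdeg wt a) (- p - Poly_Mapping.single a (- c))"
    using c(2) by (simp only: wdeg_less_uminus)
  then show ?thesis
    unfolding leads_def using c(1) by (intro exI[of _ "- c"]) simp
qed

lemma wdeg_less_mvar_mult:
  "wdeg_less wt (wt u + Suc (wt v)) (mvar u * mvar v :: ('v \<Rightarrow>\<^sub>0 nat) \<Rightarrow>\<^sub>0 'k::comm_ring_1)"
  by (rule wdeg_less_mult) (simp_all add: mvar_def wdeg_less_single)

lemma wdeg_less_param_mult:
  assumes "i < w"
  shows "wdeg_less (param_wt s) w (mvar (RPar j) * mvar (SPar i) :: _ \<Rightarrow>\<^sub>0 'k::comm_ring_1)"
  by (rule wdeg_less_mono[OF wdeg_less_mvar_mult]) (use assms in \<open>simp add: param_wt_def\<close>)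

lemma leads_x_param:
  assumes "s \<le> i" "t \<le> j" "i < j"
  shows "leads (param_wt s) (x_param s t i j :: _ \<Rightarrow>\<^sub>0 'k::idom) (Poly_Mapping.single (RPar i) 1 + Poly_Mapping.single (SPar j) 1)"
proof -
  let ?q = "if j < s \<or> i < t then 0 else mvar (RPar j) * mvar (SPar i) :: _ \<Rightarrow>\<^sub>0 'k"
  have "wdeg_less (param_wt s) j ?q"
    using assms(3) by (simp add: wdeg_less_param_mult)
  then have "leads (param_wt s) (mvar (RPar i) * mvar (SPar j) + (- ?q)) (Poly_Mapping.single (RPar i) 1 + Poly_Mapping.single (SPar j) 1)"
    by (intro leads_add_less leads_mult leads_mvar) (simp only: wdeg_less_uminus, simp add: wdeg_add param_wt_def)
  then show ?thesis
    using assms by (simp add: x_param_def)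
qed

lemma wdeg_less_x_param:
  assumes "i < j"
  shows "wdeg_less (param_wt s) (Suc j) (x_param s t i j :: _ \<Rightarrow>\<^sub>0 'k::comm_ring_1)"
  unfolding x_param_def using assms by (intro wdeg_less_diff) (simp_all add: wdeg_less_param_mult)

lemma leads_x_param_sum:
  assumes st: "1 \<le> s" "s \<le> n - 2" "n - 2 < j" "t \<le> j"
  shows "leads (param_wt s) (\<Sum>k=1..n-2. x_param s t k j * mvar (TPar k) :: _ \<Rightarrow>\<^sub>0 'k::idom)
    (Poly_Mapping.single (RPar s) 1 + Poly_Mapping.single (SPar j) 1 + Poly_Mapping.single (TPar s) 1)"
    (is "leads _ ?p ?a")
proof -
  have "?p = x_param s t s j * mvar (TPar s) + (\<Sum>k\<in>{1..n-2}-{s}. x_param s t k j * mvar (TPar k))"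
    using st by (intro sum.remove) auto
  moreover have "wdeg_less (param_wt s) (wdeg (param_wt s) ?a) (\<Sum>k\<in>{1..n-2}-{s}. x_param s t k j * mvar (TPar k) :: _ \<Rightarrow>\<^sub>0 'k)"
  proof (rule wdeg_less_sum)
    fix k assume k: "k \<in> {1..n-2} - {s}"
    have "wdeg_less (param_wt s) (j + 1) (x_param s t k j * mvar (TPar k) :: _ \<Rightarrow>\<^sub>0 'k)"
      using k st by (intro wdeg_less_mult wdeg_less_x_param) (auto simp: mvar_def wdeg_less_single param_wt_def)
    then show "wdeg_less (param_wt s) (wdeg (param_wt s) ?a) (x_param s t k j * mvar (TPar k) :: _ \<Rightarrow>\<^sub>0 'k)"
      by (simp add: wdeg_add param_wt_def)
  qed
  ultimately show ?thesis
    using st by (simp only:) (intro leads_add_less leads_mult leads_x_param leads_mvar, auto)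
qed

text \<open>The bound t < n enters here: the leading term of y_n comes from x_s(n-1), which has the
  leading term r_s s_(n-1) because s \<le> n - 2 and t \<le> n - 1.\<close>

lemma leads_var_param:
  assumes st: "1 \<le> s" "s < t" "t < n" and v: "v \<in> vars_S n - schubert_vars n s t"
  shows "leads (param_wt s) (var_param n s t v :: _ \<Rightarrow>\<^sub>0 'k::idom) (lead_param n s v)"
proof (cases v)
  case (XVar i j)
  then have "s \<le> i" "t \<le> j" "i < j"
    using v by (auto simp: vars_S_def schubert_vars_def)
  then have "leads (param_wt s) (x_param s t i j :: _ \<Rightarrow>\<^sub>0 'k) (Poly_Mapping.single (RPar i) 1 + Poly_Mapping.single (SPar j) 1)"
    by (rule leads_x_param)
  then show ?thesis
    by (simp add: XVar var_param_def lead_param_def)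
next
  case (YVar j)
  consider "j = n" | "j = n - 1" | "j \<noteq> n" "j \<noteq> n - 1"
    by blast
  then show ?thesis
  proof cases
    case 1
    have "leads (param_wt s) (\<Sum>k=1..n-2. x_param s t k (n - 1) * mvar (TPar k) :: _ \<Rightarrow>\<^sub>0 'k)
      (Poly_Mapping.single (RPar s) 1 + Poly_Mapping.single (SPar (n - 1)) 1 + Poly_Mapping.single (TPar s) 1)"
      using st by (intro leads_x_param_sum) auto
    then show ?thesis
      by (simp add: YVar 1 var_param_def lead_param_def y_param_def)
  next
    case 2
    have "leads (param_wt s) (- (\<Sum>k=1..n-2. x_param s t k n * mvar (TPar k)) :: _ \<Rightarrow>\<^sub>0 'k)
      (Poly_Mapping.single (RPar s) 1 + Poly_Mapping.single (SPar n) 1 + Poly_Mapping.single (TPar s) 1)"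
      using st by (intro leads_uminus leads_x_param_sum) auto
    moreover have "n - 1 \<noteq> n"
      using st by simp
    ultimately show ?thesis
      by (simp add: YVar 2 var_param_def lead_param_def y_param_def)
  next
    case 3
    have "leads (param_wt s) (x_param s t (n - 1) n * mvar (TPar j) :: _ \<Rightarrow>\<^sub>0 'k)
       (Poly_Mapping.single (RPar (n - 1)) 1 + Poly_Mapping.single (SPar n) 1 + Poly_Mapping.single (TPar j) 1)"
      using st by (intro leads_mult leads_x_param leads_mvar) auto
    then show ?thesis
      using 3 by (simp add: YVar var_param_def lead_param_def y_param_def)
  qed
qed

section \<open>Recovering a standard monomial from its leading monomial\<close>

lemma lookup_lead:
  fixes m :: "indet \<Rightarrow>\<^sub>0 nat" and n s :: nat
  assumes m: "Poly_Mapping.keys m \<subseteq> vars_S n" and n: "2 \<le> n" and s: "1 \<le> s" "s \<le> n - 2"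
  defines "e \<equiv> \<lambda>i j. Poly_Mapping.lookup m (XVar i j)" and "h \<equiv> \<lambda>j. Poly_Mapping.lookup m (YVar j)"
  defines "L \<equiv> Poly_Mapping.lookup (mon_comp (lead_param n s) m)"
  shows "a \<le> n \<Longrightarrow> L (RPar a) = (\<Sum>j\<le>n. e a j) +
      (if a = n - 1 then \<Sum>j=1..n-2. h j else 0) + (if a = s then h (n - 1) + h n else 0)"
    and "a \<le> n \<Longrightarrow> L (SPar a) = (\<Sum>i\<le>n. e i a) +
      (if a = n then (\<Sum>j=1..n-2. h j) + h (n - 1) else 0) + (if a = n - 1 then h n else 0)"
    and "a \<in> {1..n-2} \<Longrightarrow> L (TPar a) = h a + (if a = s then h (n - 1) + h n else 0)"
proof -
  let ?A = "(\<lambda>(i, j). XVar i j) ` ({..n} \<times> {..n})"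
  have "Poly_Mapping.keys m \<subseteq> ?A \<union> YVar ` {1..n}"
    using m by (force simp: vars_S_def)
  then have "L u = (\<Sum>v\<in>?A \<union> YVar ` {1..n}. Poly_Mapping.lookup m v * Poly_Mapping.lookup (lead_param n s v) u)" for u
    unfolding L_def by (intro lookup_mon_comp) auto
  also have "\<dots> u = (\<Sum>v\<in>?A. Poly_Mapping.lookup m v * Poly_Mapping.lookup (lead_param n s v) u) +
      (\<Sum>v\<in>YVar ` {1..n}. Poly_Mapping.lookup m v * Poly_Mapping.lookup (lead_param n s v) u)" for u
    by (rule sum.union_disjoint) auto
  also have "\<dots> u = (\<Sum>i\<le>n. \<Sum>j\<le>n. e i j * Poly_Mapping.lookup (lead_param n s (XVar i j)) u) +
      (\<Sum>j=1..n. h j * Poly_Mapping.lookup (lead_param n s (YVar j)) u)" for u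
    by (subst (1 2) sum.reindex)
      (auto simp: inj_on_def e_def h_def sum.cartesian_product intro!: sum.cong)
  also have "\<dots> u = (\<Sum>i\<le>n. \<Sum>j\<le>n. e i j * Poly_Mapping.lookup (lead_param n s (XVar i j)) u) +
      (h n * Poly_Mapping.lookup (lead_param n s (YVar n)) u +
       (h (n - 1) * Poly_Mapping.lookup (lead_param n s (YVar (n - 1))) u +
        (\<Sum>j=1..n-2. h j * Poly_Mapping.lookup (lead_param n s (YVar j)) u)))" for u
    by (simp only: sum_last_two[OF n])
  also have "(\<Sum>j=1..n-2. h j * Poly_Mapping.lookup (lead_param n s (YVar j)) u) =
      (\<Sum>j=1..n-2. h j * Poly_Mapping.lookup (Poly_Mapping.single (RPar (n - 1)) 1 + Poly_Mapping.single (SPar n) 1 +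
        Poly_Mapping.single (TPar j) 1) u)" for u
    using n by (intro sum.cong refl) (auto simp: lead_param_def)
  finally have L: "L u = (\<Sum>i\<le>n. \<Sum>j\<le>n. e i j * Poly_Mapping.lookup (lead_param n s (XVar i j)) u) +
      (h n * Poly_Mapping.lookup (lead_param n s (YVar n)) u +
       (h (n - 1) * Poly_Mapping.lookup (lead_param n s (YVar (n - 1))) u +
        (\<Sum>j=1..n-2. h j * Poly_Mapping.lookup (Poly_Mapping.single (RPar (n - 1)) 1 + Poly_Mapping.single (SPar n) 1 +
        Poly_Mapping.single (TPar j) 1) u)))" for u .
  note simps = lead_param_def Poly_Mapping.lookup_add Poly_Mapping.lookup_single
  have if_sum: "(\<Sum>j\<in>B. if c then f j else 0) = (if c then sum f B else 0)" for B c and f :: "nat \<Rightarrow> nat"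
    by simp
  have e: "e i j * Poly_Mapping.lookup (lead_param n s (XVar i j)) (RPar a) = (if i = a then e a j else 0)"
    "e i j * Poly_Mapping.lookup (lead_param n s (XVar i j)) (SPar a) = (if j = a then e i a else 0)"
    "e i j * Poly_Mapping.lookup (lead_param n s (XVar i j)) (TPar a) = 0" for i j a
    by (simp_all add: simps)
  have h: "h j * Poly_Mapping.lookup (Poly_Mapping.single (RPar (n - 1)) 1 + Poly_Mapping.single (SPar n) 1 +
      Poly_Mapping.single (TPar j) 1) (RPar a) = (if a = n - 1 then h j else 0)"
    "h j * Poly_Mapping.lookup (Poly_Mapping.single (RPar (n - 1)) 1 + Poly_Mapping.single (SPar n) 1 +
      Poly_Mapping.single (TPar j) 1) (SPar a) = (if a = n then h j else 0)"
    "h j * Poly_Mapping.lookup (Poly_Mapping.single (RPar (n - 1)) 1 + Poly_Mapping.single (SPar n) 1 +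
      Poly_Mapping.single (TPar j) 1) (TPar a) = (if j = a then h a else 0)" for j a
    by (auto simp: simps when_def)
  have "(\<Sum>i\<le>n. \<Sum>j\<le>n. if i = a then e a j else 0) = (\<Sum>j\<le>n. e a j)" if "a \<le> n"
    using that by (subst sum.swap) simp
  then show "L (RPar a) = (\<Sum>j\<le>n. e a j) +
      (if a = n - 1 then \<Sum>j=1..n-2. h j else 0) + (if a = s then h (n - 1) + h n else 0)" if "a \<le> n"
    unfolding L e h if_sum using that n by (auto simp: simps when_def)
  show "L (SPar a) = (\<Sum>i\<le>n. e i a) +
      (if a = n then (\<Sum>j=1..n-2. h j) + h (n - 1) else 0) + (if a = n - 1 then h n else 0)" if "a \<le> n"
    unfolding L e h if_sum using n that by (auto simp: simps when_def)
  show "L (TPar a) = h a + (if a = s then h (n - 1) + h n else 0)" if "a \<in> {1..n-2}"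
    unfolding L e h using n that by (auto simp: simps when_def)
qed

text \<open>
  The exponents of the three kinds of \<open>y\<close> are read off first, from truncated differences that
  are correct because a standard monomial does not contain the respective \<open>x\<close>; the remaining
  exponents form a chain, which is determined by its row and column sums.
\<close>

lemma inj_on_lead_param:
  assumes st: "1 \<le> s" "s < t" "t < n"
  shows "inj_on (mon_comp (lead_param n s)) {m. standard n s t m}"
proof (rule inj_onI)
  fix m m' assume mm: "m \<in> {m. standard n s t m}" "m' \<in> {m. standard n s t m}"
    and eq: "mon_comp (lead_param n s) m = mon_comp (lead_param n s) m'"
  define L where "L = Poly_Mapping.lookup (mon_comp (lead_param n s) m)"
  have n: "2 \<le> n" "s \<le> n - 2" "s \<noteq> n - 1"
    using st by auto
  \<comment> \<open>The leading monomial of every y_j contains exactly one T, to the first power, so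
    D is the total degree in y.\<close>
  define D where "D = (\<Sum>a=1..n-2. L (TPar a))"
  have main: "Poly_Mapping.lookup m (YVar n) = D - L (SPar n)"
    "Poly_Mapping.lookup m (YVar (n - 1)) = D - Poly_Mapping.lookup m (YVar n) - L (RPar (n - 1))"
    if std: "standard n s t m" and L: "L = Poly_Mapping.lookup (mon_comp (lead_param n s) m)" for m
  proof -
    define e where "e = (\<lambda>i j. Poly_Mapping.lookup m (XVar i j))"
    define h where "h = (\<lambda>j. Poly_Mapping.lookup m (YVar j))"
    have m: "Poly_Mapping.keys m \<subseteq> vars_S n"
      using std by (auto simp: standard_def)
    note lookups = lookup_lead[OF m n(1) st(1) n(2), folded L]
    have "D = (\<Sum>a=1..n-2. h a) + (\<Sum>a=1..n-2. if a = s then h (n - 1) + h n else 0)"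
      unfolding D_def sum.distrib[symmetric] by (intro sum.cong refl) (simp only: lookups(3) h_def)
    then have D: "D = (\<Sum>a=1..n-2. h a) + h (n - 1) + h n"
      using st n by simp
    have SN: "L (SPar n) = (\<Sum>i\<le>n. e i n) + (\<Sum>j=1..n-2. h j) + h (n - 1)"
      using lookups(2)[of n] n by (simp add: e_def h_def)
    have RN: "L (RPar (n - 1)) = (\<Sum>j\<le>n. e (n - 1) j) + (\<Sum>j=1..n-2. h j)"
      using lookups(1)[of "n - 1"] n by (simp add: e_def h_def)
    have hn: "e i n = 0" if "h n \<noteq> 0" for i
      using that std by (auto simp: standard_def e_def h_def in_keys_iff)
    have row: "e (n - 1) j = 0" if "j \<noteq> n" for j
    proof (rule ccontr)
      assume "e (n - 1) j \<noteq> 0"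
      then have "XVar (n - 1) j \<in> vars_S n"
        using m by (auto simp: e_def in_keys_iff)
      then show False
        using that by (auto simp: vars_S_def)
    qed
    have hn1: "e (n - 1) n = 0" if "h (n - 1) \<noteq> 0"
      using that std by (auto simp: standard_def e_def h_def in_keys_iff)
    have "h n = D - L (SPar n)"
      using hn D SN by (cases "h n = 0") auto
    then show "Poly_Mapping.lookup m (YVar n) = D - L (SPar n)"
      by (simp add: h_def)
    have "(\<Sum>j\<le>n. e (n - 1) j) = e (n - 1) n"
      using row by (intro sum.mono_neutral_right[of "{..n}" "{n}", simplified]) auto
    then have "h (n - 1) = D - h n - L (RPar (n - 1))"
      using hn1 D RN by (cases "h (n - 1) = 0") auto
    then show "Poly_Mapping.lookup m (YVar (n - 1)) = D - Poly_Mapping.lookup m (YVar n) - L (RPar (n - 1))"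
      by (simp add: h_def)
  qed
  have std: "standard n s t m" "standard n s t m'"
    using mm by auto
  have keys: "Poly_Mapping.keys m \<subseteq> vars_S n" "Poly_Mapping.keys m' \<subseteq> vars_S n"
    using std by (auto simp: standard_def)
  have L': "L = Poly_Mapping.lookup (mon_comp (lead_param n s) m')"
    by (simp add: L_def eq)
  note lm = lookup_lead[OF keys(1) n(1) st(1) n(2), folded L_def]
  note lm' = lookup_lead[OF keys(2) n(1) st(1) n(2), folded L']
  have yn: "Poly_Mapping.lookup m (YVar n) = Poly_Mapping.lookup m' (YVar n)"
    "Poly_Mapping.lookup m (YVar (n - 1)) = Poly_Mapping.lookup m' (YVar (n - 1))"
    using main[OF std(1) L_def] main[OF std(2) L'] by simp_all
  have y: "Poly_Mapping.lookup m (YVar j) = Poly_Mapping.lookup m' (YVar j)" if "j \<in> {1..n-2}" for j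
    using lm(3)[OF that] lm'(3)[OF that] yn by (simp split: if_splits)
  then have ysum: "(\<Sum>j=1..n-2. Poly_Mapping.lookup m (YVar j)) = (\<Sum>j=1..n-2. Poly_Mapping.lookup m' (YVar j))"
    by (rule sum.cong[OF refl])
  have chain: "Poly_Mapping.lookup m (XVar i j) = 0 \<or> Poly_Mapping.lookup m (XVar k l) = 0"
    if "standard n s t m" "i < k" "l < j" for m i j k l
  proof (rule ccontr)
    assume "\<not> ?thesis"
    then have *: "XVar i j \<in> Poly_Mapping.keys m" "XVar k l \<in> Poly_Mapping.keys m"
      by (auto simp: in_keys_iff)
    then have "XVar k l \<in> vars_S n"
      using that(1) unfolding standard_def by blast
    then have "k < l"
      by (simp add: vars_S_def)
    then show False
      using * that unfolding standard_def by blast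
  qed
  have x: "Poly_Mapping.lookup m (XVar i j) = Poly_Mapping.lookup m' (XVar i j)" if "i \<le> n" "j \<le> n" for i j
  proof (rule chain_eqI[where N = "Suc n" and e = "\<lambda>i j. Poly_Mapping.lookup m (XVar i j)"
      and e' = "\<lambda>i j. Poly_Mapping.lookup m' (XVar i j)"])
    show "(\<Sum>j<Suc n. Poly_Mapping.lookup m (XVar i j)) = (\<Sum>j<Suc n. Poly_Mapping.lookup m' (XVar i j))"
      if "i < Suc n" for i
      using lm(1)[of i] lm'(1)[of i] that yn ysum unfolding lessThan_Suc_atMost
      by (simp split: if_splits)
    show "(\<Sum>i<Suc n. Poly_Mapping.lookup m (XVar i j)) = (\<Sum>i<Suc n. Poly_Mapping.lookup m' (XVar i j))"
      if "j < Suc n" for j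
      using lm(2)[of j] lm'(2)[of j] that yn ysum unfolding lessThan_Suc_atMost
      by (simp split: if_splits)
  qed (use chain std that in auto)
  show "m = m'"
  proof (rule poly_mapping_eqI)
    fix v
    have out: "Poly_Mapping.lookup m v = 0 \<and> Poly_Mapping.lookup m' v = 0" if "v \<notin> vars_S n"
      using that keys by (auto simp: in_keys_iff)
    show "Poly_Mapping.lookup m v = Poly_Mapping.lookup m' v"
    proof (cases "v \<in> vars_S n")
      case True
      show ?thesis
      proof (cases v)
        case (XVar i j)
        then show ?thesis
          using True x[of i j] by (auto simp: vars_S_def)
      next
        case (YVar j)
        then have "j = n \<or> j = n - 1 \<or> j \<in> {1..n-2}"
          using True by (auto simp: vars_S_def)
        then show ?thesis
          using yn y YVar by auto
      qed
    qed (simp add: out)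
  qed
qed

text \<open>x_st is the least surviving indeterminate, hence nested with no other: an outer partner
  x_il would need i < s, an inner partner x_jk would need k < t. As t < n, it is not among the x
  that exclude a y.\<close>

lemma standard_add_x:
  assumes st: "1 \<le> s" "s < t" "t < n" and m: "standard n s t m"
  shows "standard n s t (Poly_Mapping.single (XVar s t) 1 + m)"
proof -
  have keys: "Poly_Mapping.keys (Poly_Mapping.single (XVar s t) 1 + m) = insert (XVar s t) (Poly_Mapping.keys m)"
    by (auto simp: in_keys_iff Poly_Mapping.lookup_add Poly_Mapping.lookup_single when_def split: if_splits)
  have vars: "Poly_Mapping.keys m \<subseteq> vars_S n - schubert_vars n s t"
    using m unfolding standard_def by blast
  have le: "s \<le> i \<and> t \<le> j" if "XVar i j \<in> Poly_Mapping.keys m" for i j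
    using subsetD[OF vars that] by (auto simp: vars_S_def schubert_vars_def)
  have "XVar s t \<in> vars_S n - schubert_vars n s t"
    using st by (auto simp: vars_S_def schubert_vars_def)
  with vars have "insert (XVar s t) (Poly_Mapping.keys m) \<subseteq> vars_S n - schubert_vars n s t"
    by blast
  moreover have "XVar j k \<notin> insert (XVar s t) (Poly_Mapping.keys m)"
    if ijkl: "i < j" "j < k" "k < l" and il: "XVar i l \<in> insert (XVar s t) (Poly_Mapping.keys m)" for i j k l
  proof
    assume "XVar j k \<in> insert (XVar s t) (Poly_Mapping.keys m)"
    then consider "j = s" "k = t" "XVar i l \<in> Poly_Mapping.keys m" | "i = s" "l = t" "XVar j k \<in> Poly_Mapping.keys m"
      | "XVar i l \<in> Poly_Mapping.keys m" "XVar j k \<in> Poly_Mapping.keys m" | "i = j"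
      using il by blast
    then show False
    proof cases
      case 3
      then show ?thesis using m ijkl unfolding standard_def by blast
    qed (use le ijkl in fastforce)+
  qed
  ultimately show ?thesis
    using m st unfolding standard_def keys by auto
qed

lemma lookup_single_mult:
  fixes q :: "'m::cancel_comm_monoid_add \<Rightarrow>\<^sub>0 'k::comm_semiring_1"
  shows "Poly_Mapping.lookup (Poly_Mapping.single a 1 * q) (a + m) = Poly_Mapping.lookup q m"
proof -
  have "Poly_Mapping.single a 1 * q =
      (\<Sum>m\<in>Poly_Mapping.keys q. Poly_Mapping.single (a + m) (Poly_Mapping.lookup q m))"
    by (subst poly_mapping_eq_sum_single[of q]) (simp add: sum_distrib_left Poly_Mapping.mult_single)
  then show ?thesis
    by (auto simp: Poly_Mapping.lookup_sum Poly_Mapping.lookup_single when_def in_keys_iff)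
qed

lemma x_nonzerodivisor:
  fixes p :: "'k::idom mpoly"
  assumes st: "1 \<le> s" "s < t" "t < n"
    and p: "p \<in> carrier (S_alg n)" "x_poly s t * p \<in> J_plus n (schubert_vars n s t)"
  shows "p \<in> J_plus n (schubert_vars n s t)"
proof -
  let ?V = "schubert_vars n s t" and ?v = "Poly_Mapping.single (XVar s t) (1 :: nat)"
  have n: "2 \<le> n"
    using st by simp
  obtain q where q: "\<forall>m\<in>Poly_Mapping.keys q. standard n s t m" "p - q \<in> J_plus n ?V"
    using standard_spanning[OF n p(1)] .
  have x: "x_poly s t = (Poly_Mapping.single ?v 1 :: 'k mpoly)"
    using st by (simp add: x_poly_def Var_def)
  have xc: "x_poly s t \<in> carrier (S_alg n :: ('k, 'k mpoly) module)"
    using st by (intro carrier_S_x) auto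
  have "x_poly s t * p - x_poly s t * (p - q) \<in> J_plus n ?V"
    by (rule J_plus_diff[OF p(2) J_plus_mult[OF xc q(2)]])
  then have xq: "x_poly s t * q \<in> J_plus n ?V"
    by (simp add: right_diff_distrib)
  have keys: "standard n s t m" if "m \<in> Poly_Mapping.keys (x_poly s t * q)" for m
    using subsetD[OF Poly_Mapping.keys_mult that] q(1) standard_add_x[OF st] by (auto simp: x)
  \<comment> \<open>Linear independence is applied to x_st q itself: its monomials are standard, and
    the parametrisation kills it.\<close>
  have "x_poly s t * q = 0"
  proof (rule mpoly_subst_eq_0_imp_eq_0)
    show "param_hom n s t (x_poly s t * q) = 0"
      using param_hom_J_plus[OF n st(2) xq] .
    show "leads (param_wt s) (var_param n s t v :: _ \<Rightarrow>\<^sub>0 'k) (lead_param n s v)"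
      if "m \<in> Poly_Mapping.keys (x_poly s t * q)" "v \<in> Poly_Mapping.keys m" for m v
      using keys[OF that(1)] that(2) by (intro leads_var_param st) (auto simp: standard_def)
    show "inj_on (mon_comp (lead_param n s)) (Poly_Mapping.keys (x_poly s t * q))"
      by (rule inj_on_subset[OF inj_on_lead_param[OF st]]) (use keys in auto)
  qed
  moreover have "Poly_Mapping.lookup (x_poly s t * q) (?v + m) = Poly_Mapping.lookup q m" for m
    unfolding x by (simp add: lookup_single_mult)
  ultimately have "q = 0"
    by (intro poly_mapping_eqI) (metis lookup_zero)
  then show ?thesis
    using q(2) by simp
qed

section \<open>Derivations and homomorphisms modulo the ideal\<close>

lemma mpoly_vars_induct [consumes 1, case_names const var add mult]:
  fixes p :: "('v \<Rightarrow>\<^sub>0 nat) \<Rightarrow>\<^sub>0 'k::comm_semiring_1"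
  assumes vars: "\<forall>m\<in>Poly_Mapping.keys p. Poly_Mapping.keys m \<subseteq> V"
    and const: "\<And>c. P (Poly_Mapping.single 0 c)"
    and var: "\<And>v. v \<in> V \<Longrightarrow> P (Poly_Mapping.single (Poly_Mapping.single v 1) 1)"
    and add: "\<And>p q. P p \<Longrightarrow> P q \<Longrightarrow> P (p + q)"
    and mult: "\<And>p q. P p \<Longrightarrow> P q \<Longrightarrow> P (p * q)"
  shows "P p"
proof -
  have zero: "P 0" and one: "P 1"
    using const[of 0] const[of 1] by simp_all
  have power: "P (Poly_Mapping.single (Poly_Mapping.single v k) 1)" if "v \<in> V" for v k
  proof (induction k)
    case (Suc k)
    have "Poly_Mapping.single (Poly_Mapping.single v (Suc k)) 1 =
        Poly_Mapping.single (Poly_Mapping.single v 1) 1 * Poly_Mapping.single (Poly_Mapping.single v k) (1 :: 'k)"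
      by (simp add: Poly_Mapping.mult_single flip: Poly_Mapping.single_add)
    then show ?case
      using mult[OF var[OF that] Suc] by simp
  qed (simp add: one)
  have monomials: "P (Poly_Mapping.single (\<Sum>v\<in>A. Poly_Mapping.single v (e v)) 1)" if "A \<subseteq> V" for A e
    using that
  proof (induction A rule: infinite_finite_induct)
    case (insert v A)
    then show ?case
      using mult[OF power[of v "e v"], of "Poly_Mapping.single (\<Sum>v\<in>A. Poly_Mapping.single v (e v)) 1"]
      by (simp add: Poly_Mapping.mult_single)
  qed (simp_all add: one)
  have "P (Poly_Mapping.single m c)" if "Poly_Mapping.keys m \<subseteq> V" for m c
  proof -
    have "P (Poly_Mapping.single m 1)"
      using monomials[OF that, of "Poly_Mapping.lookup m"] by (simp flip: poly_mapping_eq_sum_single)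
    then show ?thesis
      using mult[OF const, of "Poly_Mapping.single m 1" c] by (simp add: Poly_Mapping.mult_single)
  qed
  then have "P (\<Sum>m\<in>A. Poly_Mapping.single m (Poly_Mapping.lookup p m))" if "A \<subseteq> Poly_Mapping.keys p" for A
    using that vars by (induction A rule: infinite_finite_induct) (simp_all add: zero add)
  then show ?thesis
    by (subst poly_mapping_eq_sum_single) blast
qed

lemma carrier_S_induct [consumes 1, case_names const var add mult]:
  fixes p :: "'k::comm_ring_1 mpoly"
  assumes "p \<in> carrier (S_alg n)" "\<And>c. P (Poly_Mapping.single 0 c)" "\<And>v. v \<in> vars_S n \<Longrightarrow> P (Var v)"
    and "\<And>p q. p \<in> carrier (S_alg n) \<Longrightarrow> q \<in> carrier (S_alg n) \<Longrightarrow> P p \<Longrightarrow> P q \<Longrightarrow> P (p + q)"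
    and "\<And>p q. p \<in> carrier (S_alg n) \<Longrightarrow> q \<in> carrier (S_alg n) \<Longrightarrow> P p \<Longrightarrow> P q \<Longrightarrow> P (p * q)"
  shows "P p"
proof -
  have "\<forall>m\<in>Poly_Mapping.keys p. Poly_Mapping.keys m \<subseteq> vars_S n"
    using assms(1) by (simp add: S_alg_def)
  then have "p \<in> carrier (S_alg n) \<and> P p"
    using assms(2-)
    by (induction p rule: mpoly_vars_induct)
      (auto simp: carrier_S_closed carrier_S_Var Var_def[symmetric] simp del: One_nat_def)
  then show ?thesis ..
qed

text \<open>
  The derivation with prescribed values \<open>d v\<close> on the indeterminates is the coefficient of
  \<open>\<epsilon>\<close> in the substitution \<open>v \<mapsto> v + \<epsilon> d v\<close>.
\<close>

definition deform :: "(indet \<Rightarrow> 'k mpoly) \<Rightarrow> 'k::comm_ring_1 mpoly \<Rightarrow> 'k mpoly poly" where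
  "deform d = mpoly_subst (\<lambda>c. [:Poly_Mapping.single 0 c:]) (\<lambda>v. [:Var v, d v:])"

definition deriv_of :: "(indet \<Rightarrow> 'k mpoly) \<Rightarrow> 'k::comm_ring_1 mpoly \<Rightarrow> 'k mpoly" where
  "deriv_of d p = coeff (deform d p) 1"

interpretation dual: coeff_hom "\<lambda>c :: 'k::comm_ring_1. [:Poly_Mapping.single (0 :: indet \<Rightarrow>\<^sub>0 nat) c:]"
  by unfold_locales
    (simp_all add: Poly_Mapping.single_add Poly_Mapping.mult_single one_pCons mult.commute)

lemma deform_Var: "deform d (Var v) = [:Var v, d v:]"
  by (simp add: deform_def Var_def)

lemma deform_const: "deform d (Poly_Mapping.single 0 c) = [:Poly_Mapping.single 0 c:]"
  by (simp add: deform_def)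

lemma coeff_deform_0: "coeff (deform d p) 0 = (p :: 'k::comm_ring_1 mpoly)"
proof -
  have "\<forall>m\<in>Poly_Mapping.keys p. Poly_Mapping.keys m \<subseteq> UNIV"
    by simp
  then show ?thesis
  proof (induction p rule: mpoly_vars_induct)
    case (var v)
    then show ?case by (simp add: deform_Var flip: Var_def One_nat_def)
  qed (simp_all add: deform_const deform_def dual.mpoly_subst_hom coeff_mult)
qed

lemma deriv_of_Var [simp]: "deriv_of d (Var v) = d v"
  by (simp add: deriv_of_def deform_Var)

lemma deriv_of_const [simp]: "deriv_of d (Poly_Mapping.single 0 c) = 0"
  by (simp add: deriv_of_def deform_const)

lemma deriv_of_add: "deriv_of d (p + q) = deriv_of d p + deriv_of d q"
  by (simp add: deriv_of_def deform_def dual.mpoly_subst_hom)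

lemma deriv_of_diff: "deriv_of d (p - q) = deriv_of d p - deriv_of d q"
  by (simp add: deriv_of_def deform_def dual.mpoly_subst_hom)

lemma deriv_of_sum: "deriv_of d (sum f A) = (\<Sum>i\<in>A. deriv_of d (f i))"
  by (simp add: deriv_of_def deform_def dual.mpoly_subst_hom coeff_sum)

lemma deriv_of_uminus: "deriv_of d (- p) = - deriv_of d p"
  by (simp add: deriv_of_def deform_def dual.mpoly_subst_hom)

text \<open>The coefficient of \<epsilon> in a product of two values of \<open>deform d\<close>.
  Powers of \<epsilon> are not truncated, but coefficients 0 and 1 of a product depend only on
  coefficients 0 and 1 of the factors, as for dual numbers.\<close>

lemma deriv_of_mult: "deriv_of d (p * q) = p * deriv_of d q + q * deriv_of d p"
proof -
  have "coeff (deform d p * deform d q) 1 = coeff (deform d p) 0 * coeff (deform d q) 1 + coeff (deform d p) 1 * coeff (deform d q) 0"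
    by (simp add: coeff_mult)
  then show ?thesis
    by (simp add: deriv_of_def coeff_deform_0 mult.commute) (simp add: deform_def dual.mpoly_subst_hom)
qed

text \<open>Additivity and the Leibniz rule are asked for all polynomials, which
  \<open>deriv_of\<close> satisfies and which spares side conditions. Linearity over the constants
  follows from Leibniz and the vanishing on constants.\<close>

definition derivation_S :: "nat \<Rightarrow> ('k::comm_ring_1 mpoly \<Rightarrow> 'k mpoly) \<Rightarrow> bool" where
  "derivation_S n D \<longleftrightarrow> (\<forall>p\<in>carrier (S_alg n). D p \<in> carrier (S_alg n)) \<and>
    (\<forall>p q. D (p + q) = D p + D q) \<and> (\<forall>p q. D (p * q) = p * D q + q * D p) \<and>
    (\<forall>c. D (Poly_Mapping.single 0 c) = 0)"

lemma derivation_S_deriv_of: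
  assumes "\<And>v. v \<in> vars_S n \<Longrightarrow> d v \<in> carrier (S_alg n)"
  shows "derivation_S n (deriv_of d)"
proof -
  have "deriv_of d p \<in> carrier (S_alg n)" if "p \<in> carrier (S_alg n)" for p
    using that by (induction p rule: carrier_S_induct)
      (simp_all add: assms carrier_S_closed deriv_of_add deriv_of_mult)
  then show ?thesis
    by (simp add: derivation_S_def deriv_of_add deriv_of_mult)
qed

lemma derivation_S_add:
  "derivation_S n D \<Longrightarrow> derivation_S n E \<Longrightarrow> derivation_S n (\<lambda>p. D p + E p)"
  by (auto simp: derivation_S_def carrier_S_add algebra_simps)

text \<open>Such a map picks a polynomial from each value of a homomorphism from J to S/J. The
  choice is arbitrary, so its laws hold modulo J only.\<close>

definition hom_mod_J :: "nat \<Rightarrow> ('k::comm_ring_1 mpoly \<Rightarrow> 'k mpoly) \<Rightarrow> bool" where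
  "hom_mod_J n \<psi> \<longleftrightarrow> (\<forall>f\<in>J_ideal n. \<psi> f \<in> carrier (S_alg n)) \<and>
    (\<forall>f\<in>J_ideal n. \<forall>g\<in>J_ideal n. \<psi> (f + g) - (\<psi> f + \<psi> g) \<in> J_ideal n) \<and>
    (\<forall>a\<in>carrier (S_alg n). \<forall>f\<in>J_ideal n. \<psi> (a * f) - a * \<psi> f \<in> J_ideal n)"

text \<open>On J a derivation is linear modulo J: D (a f) - a D f = f D a, and this lies in J
  together with f.\<close>

lemma hom_mod_J_diff_derivation:
  assumes \<psi>: "hom_mod_J n \<psi>" and D: "derivation_S n D"
  shows "hom_mod_J n (\<lambda>f. \<psi> f - D f)"
  unfolding hom_mod_J_def
proof (intro conjI ballI)
  show "\<psi> f - D f \<in> carrier (S_alg n)" if "f \<in> J_ideal n" for f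
    using \<psi> D that subsetD[OF J_subset_carrier that]
    by (auto simp: hom_mod_J_def derivation_S_def intro!: carrier_S_diff)
  show "\<psi> (f + g) - D (f + g) - (\<psi> f - D f + (\<psi> g - D g)) \<in> J_ideal n"
    if "f \<in> J_ideal n" "g \<in> J_ideal n" for f g
  proof -
    have "\<psi> (f + g) - D (f + g) - (\<psi> f - D f + (\<psi> g - D g)) = \<psi> (f + g) - (\<psi> f + \<psi> g)"
      using D by (simp add: derivation_S_def)
    then show ?thesis
      using \<psi> that by (simp only: hom_mod_J_def)
  qed
  show "\<psi> (a * f) - D (a * f) - a * (\<psi> f - D f) \<in> J_ideal n"
    if "a \<in> carrier (S_alg n)" "f \<in> J_ideal n" for a f
  proof -
    have "\<psi> (a * f) - D (a * f) - a * (\<psi> f - D f) = (\<psi> (a * f) - a * \<psi> f) - D a * f"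
      using D by (simp add: derivation_S_def algebra_simps)
    moreover have "D a * f \<in> J_ideal n"
      using D that by (intro J_mult) (auto simp: derivation_S_def)
    ultimately show ?thesis
      using \<psi> that by (simp only: hom_mod_J_def J_diff)
  qed
qed

lemma hom_mod_J_zero:
  assumes "hom_mod_J n \<psi>"
  shows "\<psi> 0 \<in> J_ideal n"
proof -
  have "\<psi> (0 + 0) - (\<psi> 0 + \<psi> 0) \<in> J_ideal n"
    using assms J_zero unfolding hom_mod_J_def by blast
  then show ?thesis
    using J_uminus by fastforce
qed

lemma hom_mod_J_sum_list:
  assumes \<psi>: "hom_mod_J n \<psi>" and xs: "\<forall>(a, f)\<in>set xs. a \<in> carrier (S_alg n) \<and> f \<in> J_ideal n"
  shows "\<psi> (\<Sum>(a, f)\<leftarrow>xs. a * f) - (\<Sum>(a, f)\<leftarrow>xs. a * \<psi> f) \<in> J_ideal n"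
    and "(\<Sum>(a, f)\<leftarrow>xs. a * f) \<in> J_ideal n"
proof -
  have "\<psi> (\<Sum>(a, f)\<leftarrow>xs. a * f) - (\<Sum>(a, f)\<leftarrow>xs. a * \<psi> f) \<in> J_ideal n \<and> (\<Sum>(a, f)\<leftarrow>xs. a * f) \<in> J_ideal n"
    using xs
  proof (induction xs)
    case Nil
    then show ?case
      using hom_mod_J_zero[OF \<psi>] by (simp add: J_zero)
  next
    case (Cons af xs)
    obtain a f where af: "af = (a, f)"
      by (cases af)
    let ?s = "\<Sum>(a, f)\<leftarrow>xs. a * f" and ?t = "\<Sum>(a, f)\<leftarrow>xs. a * \<psi> f"
    have IH: "\<psi> ?s - ?t \<in> J_ideal n" "?s \<in> J_ideal n" and a: "a \<in> carrier (S_alg n)" "f \<in> J_ideal n"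
      using Cons by (simp_all add: af)
    have "\<psi> (a * f + ?s) - (\<psi> (a * f) + \<psi> ?s) \<in> J_ideal n" "\<psi> (a * f) - a * \<psi> f \<in> J_ideal n"
      using \<psi> IH a J_mult[OF a] unfolding hom_mod_J_def by blast+
    then have "\<psi> (a * f + ?s) - (\<psi> (a * f) + \<psi> ?s) + ((\<psi> (a * f) - a * \<psi> f) + (\<psi> ?s - ?t)) \<in> J_ideal n"
      using IH by (intro J_add)
    then show ?case
      using J_add[OF J_mult[OF a] IH(2)] by (simp add: af algebra_simps)
  qed
  then show "\<psi> (\<Sum>(a, f)\<leftarrow>xs. a * f) - (\<Sum>(a, f)\<leftarrow>xs. a * \<psi> f) \<in> J_ideal n"
    and "(\<Sum>(a, f)\<leftarrow>xs. a * f) \<in> J_ideal n"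
    by blast+
qed

text \<open>Applying \<psi> to a syzygy of elements of J gives a syzygy of their values modulo J.
  This is how the values on the Pfaffians get constrained.\<close>

lemma hom_mod_J_relation:
  assumes "hom_mod_J n \<psi>" "\<forall>(a, f)\<in>set xs. a \<in> carrier (S_alg n) \<and> f \<in> J_ideal n"
    and "(\<Sum>(a, f)\<leftarrow>xs. a * f) = 0"
  shows "(\<Sum>(a, f)\<leftarrow>xs. a * \<psi> f) \<in> J_ideal n"
  using J_diff[OF hom_mod_J_zero[OF assms(1)] hom_mod_J_sum_list(1)[OF assms(1,2)]] assms(3) by simp

text \<open>An ideal by \<open>ideal_ker_mod_J\<close>; so \<psi> represents the zero homomorphism
  as soon as all generators of J belong to it.\<close>

definition ker_mod_J :: "nat \<Rightarrow> ('k::comm_ring_1 mpoly \<Rightarrow> 'k mpoly) \<Rightarrow> 'k mpoly set" where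
  "ker_mod_J n \<psi> = {f \<in> J_ideal n. \<psi> f \<in> J_ideal n}"

lemma ker_mod_J_add:
  assumes \<psi>: "hom_mod_J n \<psi>" and "f \<in> ker_mod_J n \<psi>" "g \<in> ker_mod_J n \<psi>"
  shows "f + g \<in> ker_mod_J n \<psi>"
proof -
  have "\<psi> (f + g) - (\<psi> f + \<psi> g) + (\<psi> f + \<psi> g) \<in> J_ideal n"
    using assms by (intro J_add) (auto simp: hom_mod_J_def ker_mod_J_def)
  then show ?thesis
    using assms by (simp add: ker_mod_J_def J_add)
qed

lemma ker_mod_J_mult:
  assumes \<psi>: "hom_mod_J n \<psi>" and "a \<in> carrier (S_alg n)" "f \<in> ker_mod_J n \<psi>"
  shows "a * f \<in> ker_mod_J n \<psi>"
proof -
  have "\<psi> (a * f) - a * \<psi> f + a * \<psi> f \<in> J_ideal n"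
    using assms by (intro J_add J_mult) (auto simp: hom_mod_J_def ker_mod_J_def)
  then show ?thesis
    using assms by (simp add: ker_mod_J_def J_mult)
qed

lemma ker_mod_J_uminus:
  "hom_mod_J n \<psi> \<Longrightarrow> f \<in> ker_mod_J n \<psi> \<Longrightarrow> - f \<in> ker_mod_J n \<psi>"
  using ker_mod_J_mult[of n \<psi> "- 1" f] by (simp add: carrier_S_closed)

lemma ker_mod_J_diff:
  "hom_mod_J n \<psi> \<Longrightarrow> f \<in> ker_mod_J n \<psi> \<Longrightarrow> g \<in> ker_mod_J n \<psi> \<Longrightarrow> f - g \<in> ker_mod_J n \<psi>"
  using ker_mod_J_add[of n \<psi> f "- g"] by (simp add: ker_mod_J_uminus)

lemma ker_mod_J_zero: "hom_mod_J n \<psi> \<Longrightarrow> 0 \<in> ker_mod_J n \<psi>"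
  by (simp add: ker_mod_J_def J_zero hom_mod_J_zero)

lemma ker_mod_J_sum:
  "hom_mod_J n \<psi> \<Longrightarrow> (\<And>i. i \<in> A \<Longrightarrow> f i \<in> ker_mod_J n \<psi>) \<Longrightarrow> sum f A \<in> ker_mod_J n \<psi>"
  by (induction A rule: infinite_finite_induct) (simp_all add: ker_mod_J_add ker_mod_J_zero)

section \<open>Cancellation of x_12\<close>

lemma schubert_vars_1_2: "schubert_vars n 1 2 = {}"
  by (auto simp: schubert_vars_def)

text \<open>The Schubert ideal of the pair (1,2) is 0, so x_12 is a nonzerodivisor modulo J itself;
  the bound on n is t < n for t = 2.\<close>

lemma ker_mod_J_cancel:
  fixes \<psi> :: "'k::idom mpoly \<Rightarrow> 'k mpoly"
  assumes n: "3 \<le> n" and \<psi>: "hom_mod_J n \<psi>" and f: "f \<in> J_ideal n" "x_poly 1 2 * f \<in> ker_mod_J n \<psi>"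
  shows "f \<in> ker_mod_J n \<psi>"
proof -
  have x: "x_poly 1 2 \<in> carrier (S_alg n :: ('k, 'k mpoly) module)"
    using n by (intro carrier_S_x) auto
  have hom: "\<psi> (x_poly 1 2 * f) - x_poly 1 2 * \<psi> f \<in> J_ideal n"
    using \<psi> f(1) x unfolding hom_mod_J_def by blast
  have ker: "\<psi> (x_poly 1 2 * f) \<in> J_ideal n"
    using f(2) by (simp add: ker_mod_J_def)
  have "x_poly 1 2 * \<psi> f \<in> J_plus n (schubert_vars n 1 2)"
    using J_diff[OF ker hom] by (simp add: schubert_vars_1_2 flip: One_nat_def)
  then have "\<psi> f \<in> J_plus n (schubert_vars n 1 2)"
    by (rule x_nonzerodivisor[rotated 4]) (use n \<psi> f(1) in \<open>auto simp: hom_mod_J_def\<close>)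
  then show ?thesis
    using f(1) by (simp add: ker_mod_J_def schubert_vars_1_2 flip: One_nat_def)
qed

section \<open>Syzygies of the generators\<close>

declare One_nat_def [simp del]

text \<open>Up to sign, the expansion along the first row of the Pfaffian on the indices p, p, a, b,
  c, d, which vanishes because p is repeated.\<close>

lemma plucker_syzygy:
  "x_poly p a * \<Phi>_poly p b c d - x_poly p b * \<Phi>_poly p a c d + x_poly p c * \<Phi>_poly p a b d - x_poly p d * \<Phi>_poly p a b c
    = (0 :: 'k::comm_ring_1 mpoly)"
  unfolding \<Phi>_poly_def by (simp add: algebra_simps)

text \<open>With the terms in x_pi and x_qi moved to the left, both sides consist of those terms of
  the Pfaffian on p, q, i, j, k, l whose perfect matching joins two of p, q, i; equivalently, two of
  j, k, l. The identity brings p and q into the indices of Phi.\<close>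

lemma Phi_expand:
  "x_poly p q * \<Phi>_poly i j k l = x_poly k l * \<Phi>_poly p q i j - x_poly j l * \<Phi>_poly p q i k + x_poly j k * \<Phi>_poly p q i l
    + x_poly p i * \<Phi>_poly q j k l - (x_poly q i * \<Phi>_poly p j k l :: 'k::comm_ring_1 mpoly)"
  unfolding \<Phi>_poly_def by (simp add: algebra_simps)

text \<open>Contraction of the last index of Phi_ijkl with y.\<close>

lemma f_syzygy:
  "x_poly i j * f_poly n k - x_poly i k * f_poly n j + x_poly j k * f_poly n i =
    (\<Sum>l=1..n. y_poly l * \<Phi>_poly i j k l :: 'k::comm_ring_1 mpoly)"
proof -
  have "x_poly j k * f_poly n i = (\<Sum>l=1..n. x_poly i l * x_poly j k * y_poly l :: 'k mpoly)"
    by (simp add: f_poly_def sum_distrib_left mult_ac)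
  then show ?thesis
    by (simp add: f_poly_def \<Phi>_poly_def sum_distrib_left sum.distrib sum_subtractf algebra_simps)
qed

lemma plucker_relation:
  fixes \<psi> :: "'k::comm_ring_1 mpoly \<Rightarrow> 'k mpoly"
  assumes \<psi>: "hom_mod_J n \<psi>" and i: "p \<in> {1..n}" "a \<in> {1..n}" "b \<in> {1..n}" "c \<in> {1..n}" "d \<in> {1..n}"
  shows "x_poly p a * \<psi> (\<Phi>_poly p b c d) - x_poly p b * \<psi> (\<Phi>_poly p a c d) +
    x_poly p c * \<psi> (\<Phi>_poly p a b d) - x_poly p d * \<psi> (\<Phi>_poly p a b c) \<in> J_ideal n"
proof -
  let ?xs = "[(x_poly p a, \<Phi>_poly p b c d), (- x_poly p b, \<Phi>_poly p a c d), (x_poly p c, \<Phi>_poly p a b d),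
    (- x_poly p d, \<Phi>_poly p a b c)] :: ('k mpoly \<times> 'k mpoly) list"
  have "\<forall>(a, f)\<in>set ?xs. a \<in> carrier (S_alg n) \<and> f \<in> J_ideal n"
    using i by (simp add: carrier_S_x carrier_S_uminus Phi_in_J)
  from hom_mod_J_relation[OF \<psi> this] show ?thesis
    using plucker_syzygy[of p a b c d, where 'k = 'k] by (simp add: algebra_simps)
qed

section \<open>Removing the values on the Pfaffians\<close>

lemma x_in_J_plus:
  assumes "finite V" "XVar i j \<in> V" "i < j" "a \<in> carrier (S_alg n)"
  shows "x_poly i j * a \<in> (J_plus n V :: 'k::comm_ring_1 mpoly set)"
  using J_plus_mult[OF assms(4) Var_in_J_plus[OF assms(1,2)]] assms(3) by (simp add: x_poly_def mult.commute)

lemma schubert_vars_expand: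
  assumes "5 \<le> n"
  shows "schubert_vars n 1 3 = {XVar 1 2}"
    and "schubert_vars n 1 4 = {XVar 1 2, XVar 1 3, XVar 2 3}"
    and "schubert_vars n 1 5 = {XVar 1 2, XVar 1 3, XVar 2 3, XVar 1 4, XVar 2 4, XVar 3 4}"
    and "schubert_vars n 2 3 = XVar 1 ` {2..n}"
  using assms by (auto simp: schubert_vars_def)

lemma derivation_kills_1234:
  fixes \<psi> :: "'k::idom mpoly \<Rightarrow> 'k mpoly"
  assumes n: "6 \<le> n" and \<psi>: "hom_mod_J n \<psi>"
  obtains D where "derivation_S n D" "\<psi> (\<Phi>_poly 1 2 3 4) - D (\<Phi>_poly 1 2 3 4) \<in> J_ideal n"
proof -
  let ?V = "schubert_vars n 1 5" and ?E = "\<psi> (\<Phi>_poly 1 2 3 4)"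
  have V: "?V = {XVar 1 2, XVar 1 3, XVar 2 3, XVar 1 4, XVar 2 4, XVar 3 4}"
    using n by (simp add: schubert_vars_expand)
  have c: "\<psi> (\<Phi>_poly i j k l) \<in> carrier (S_alg n)" if "i \<in> {1..n}" "j \<in> {1..n}" "k \<in> {1..n}" "l \<in> {1..n}" for i j k l
    using \<psi> Phi_in_J[OF that] unfolding hom_mod_J_def by blast
  have "x_poly 1 2 * \<psi> (\<Phi>_poly 1 3 4 5) - x_poly 1 3 * \<psi> (\<Phi>_poly 1 2 4 5) +
      x_poly 1 4 * \<psi> (\<Phi>_poly 1 2 3 5) - x_poly 1 5 * ?E \<in> J_plus n ?V"
    using n by (intro J_subset_J_plus plucker_relation[OF \<psi>]) auto
  moreover have "x_poly 1 2 * \<psi> (\<Phi>_poly 1 3 4 5) - x_poly 1 3 * \<psi> (\<Phi>_poly 1 2 4 5) +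
      x_poly 1 4 * \<psi> (\<Phi>_poly 1 2 3 5) \<in> J_plus n ?V"
    using n by (intro J_plus_add J_plus_diff x_in_J_plus c) (auto simp: V)
  ultimately have "x_poly 1 5 * ?E \<in> J_plus n ?V"
    using J_plus_diff by fastforce
  then have "?E \<in> J_plus n ?V"
    by (rule x_nonzerodivisor[rotated 4]) (use n in \<open>auto intro!: c\<close>)
  then obtain e where e: "\<forall>v\<in>?V. e v \<in> carrier (S_alg n)" "?E - (\<Sum>v\<in>?V. e v * Var v) \<in> J_ideal n"
    by (auto simp: J_plus_def)
  \<comment> \<open>The derivative of Phi_1234 in x_12 is x_34, in x_13 it is - x_24, and so on.
    Each cofactor therefore goes, with its sign, to the complementary indeterminate.\<close>
  define d where "d = (\<lambda>v. if v = XVar 1 2 then e (XVar 3 4) else if v = XVar 1 3 then - e (XVar 2 4)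
    else if v = XVar 2 3 then e (XVar 1 4) else if v = XVar 1 4 then e (XVar 2 3)
    else if v = XVar 2 4 then - e (XVar 1 3) else if v = XVar 3 4 then e (XVar 1 2) else 0)"
  have "deriv_of d (\<Phi>_poly 1 2 3 4) = (\<Sum>v\<in>?V. e v * Var v)"
    by (simp add: V d_def \<Phi>_poly_def x_poly_def deriv_of_add deriv_of_diff deriv_of_mult algebra_simps)
  moreover have "derivation_S n (deriv_of d)"
    using e(1) by (intro derivation_S_deriv_of) (auto simp: V d_def carrier_S_uminus carrier_S_zero)
  ultimately show thesis
    using e(2) that by simp
qed

lemma derivation_kills_123:
  fixes \<psi> :: "'k::idom mpoly \<Rightarrow> 'k mpoly"
  assumes n: "6 \<le> n" and \<psi>: "hom_mod_J n \<psi>" and 1234: "\<psi> (\<Phi>_poly 1 2 3 4) \<in> J_ideal n"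
  obtains D where "derivation_S n D" "\<And>l. l \<in> {4..n} \<Longrightarrow> \<psi> (\<Phi>_poly 1 2 3 l) - D (\<Phi>_poly 1 2 3 l) \<in> J_ideal n"
proof -
  let ?V = "schubert_vars n 1 4"
  have V: "?V = {XVar 1 2, XVar 1 3, XVar 2 3}"
    using n by (simp add: schubert_vars_expand)
  have c: "\<psi> (\<Phi>_poly i j k l) \<in> carrier (S_alg n)" if "i \<in> {1..n}" "j \<in> {1..n}" "k \<in> {1..n}" "l \<in> {1..n}" for i j k l
    using \<psi> Phi_in_J[OF that] unfolding hom_mod_J_def by blast
  have "\<exists>e. (\<forall>v\<in>?V. e v \<in> carrier (S_alg n)) \<and> \<psi> (\<Phi>_poly 1 2 3 l) - (\<Sum>v\<in>?V. e v * Var v) \<in> J_ideal n"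
    if l: "l \<in> {4..n}" for l
  proof -
    have "x_poly 1 2 * \<psi> (\<Phi>_poly 1 3 4 l) - x_poly 1 3 * \<psi> (\<Phi>_poly 1 2 4 l) +
        x_poly 1 4 * \<psi> (\<Phi>_poly 1 2 3 l) - x_poly 1 l * \<psi> (\<Phi>_poly 1 2 3 4) \<in> J_plus n ?V" (is "?p - _ \<in> _")
      using n l by (intro J_subset_J_plus plucker_relation[OF \<psi>]) auto
    moreover have "x_poly 1 l * \<psi> (\<Phi>_poly 1 2 3 4) \<in> J_plus n ?V"
      using n l 1234 by (intro J_subset_J_plus J_mult carrier_S_x) auto
    ultimately have "?p \<in> J_plus n ?V"
      using J_plus_add by fastforce
    moreover have "x_poly 1 2 * \<psi> (\<Phi>_poly 1 3 4 l) - x_poly 1 3 * \<psi> (\<Phi>_poly 1 2 4 l) \<in> J_plus n ?V"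
      using n l by (intro J_plus_diff x_in_J_plus c) (auto simp: V)
    ultimately have "x_poly 1 4 * \<psi> (\<Phi>_poly 1 2 3 l) \<in> J_plus n ?V"
      using J_plus_diff by fastforce
    then have "\<psi> (\<Phi>_poly 1 2 3 l) \<in> J_plus n ?V"
      by (rule x_nonzerodivisor[rotated 4]) (use n l in \<open>auto intro!: c\<close>)
    then show ?thesis
      by (auto simp: J_plus_def)
  qed
  then have "\<forall>l\<in>{4..n}. \<exists>e. (\<forall>v\<in>?V. e v \<in> carrier (S_alg n)) \<and> \<psi> (\<Phi>_poly 1 2 3 l) - (\<Sum>v\<in>?V. e v * Var v) \<in> J_ideal n"
    by blast
  from bchoice[OF this] obtain e where e: "\<And>l v. l \<in> {4..n} \<Longrightarrow> v \<in> ?V \<Longrightarrow> e l v \<in> carrier (S_alg n)"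
    "\<And>l. l \<in> {4..n} \<Longrightarrow> \<psi> (\<Phi>_poly 1 2 3 l) - (\<Sum>v\<in>?V. e l v * Var v) \<in> J_ideal n"
    by blast
  \<comment> \<open>The derivatives of Phi_123l in x_1l, x_2l, x_3l are x_23, - x_13, x_12.
    Different l use different indeterminates, so all l \<ge> 5 are treated at once; those with l < 5
    stay fixed to preserve the value on Phi_1234.\<close>
  define d where "d = (\<lambda>v. case v of YVar j \<Rightarrow> 0 | XVar i l \<Rightarrow>
    if l < 5 then 0 else if i = 1 then e l (XVar 2 3) else if i = 2 then - e l (XVar 1 3)
    else if i = 3 then e l (XVar 1 2) else 0)"
  have "\<psi> (\<Phi>_poly 1 2 3 l) - deriv_of d (\<Phi>_poly 1 2 3 l) \<in> J_ideal n" if l: "l \<in> {4..n}" for l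
  proof (cases "l = 4")
    case True
    have "deriv_of d (\<Phi>_poly 1 2 3 4) = 0"
      by (simp add: d_def \<Phi>_poly_def x_poly_def deriv_of_add deriv_of_diff deriv_of_mult)
    then show ?thesis
      using True 1234 by simp
  next
    case False
    then have "deriv_of d (\<Phi>_poly 1 2 3 l) = (\<Sum>v\<in>?V. e l v * Var v)"
      using l by (simp add: V d_def \<Phi>_poly_def x_poly_def deriv_of_add deriv_of_diff deriv_of_mult algebra_simps)
    then show ?thesis
      using e(2)[OF l] by simp
  qed
  moreover have "derivation_S n (deriv_of d)"
    using e(1) n by (intro derivation_S_deriv_of)
      (auto simp: V d_def vars_S_def carrier_S_uminus carrier_S_zero)
  ultimately show thesis
    using that by blast
qed

lemma derivation_kills_12:
  fixes \<psi> :: "'k::idom mpoly \<Rightarrow> 'k mpoly"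
  assumes n: "6 \<le> n" and \<psi>: "hom_mod_J n \<psi>" and 123: "\<And>l. l \<in> {4..n} \<Longrightarrow> \<psi> (\<Phi>_poly 1 2 3 l) \<in> J_ideal n"
  obtains D where "derivation_S n D"
    "\<And>k l. 3 \<le> k \<Longrightarrow> k < l \<Longrightarrow> l \<le> n \<Longrightarrow> \<psi> (\<Phi>_poly 1 2 k l) - D (\<Phi>_poly 1 2 k l) \<in> J_ideal n"
proof -
  let ?V = "schubert_vars n 1 3"
  have V: "?V = {XVar 1 2}"
    using n by (simp add: schubert_vars_expand)
  have c: "\<psi> (\<Phi>_poly i j k l) \<in> carrier (S_alg n)" if "i \<in> {1..n}" "j \<in> {1..n}" "k \<in> {1..n}" "l \<in> {1..n}" for i j k l
    using \<psi> Phi_in_J[OF that] unfolding hom_mod_J_def by blast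
  have "\<exists>e. e \<in> carrier (S_alg n) \<and> \<psi> (\<Phi>_poly 1 2 k l) - e * Var (XVar 1 2) \<in> J_ideal n"
    if kl: "k \<in> {4..n}" "l \<in> {4..n}" for k l
  proof -
    have "x_poly 1 2 * \<psi> (\<Phi>_poly 1 3 k l) - x_poly 1 3 * \<psi> (\<Phi>_poly 1 2 k l) +
        x_poly 1 k * \<psi> (\<Phi>_poly 1 2 3 l) - x_poly 1 l * \<psi> (\<Phi>_poly 1 2 3 k) \<in> J_plus n ?V" (is "?p + ?q - ?r \<in> _")
      using n kl by (intro J_subset_J_plus plucker_relation[OF \<psi>]) auto
    moreover have "?q - ?r \<in> J_plus n ?V"
      using n kl 123 by (intro J_subset_J_plus J_diff J_mult carrier_S_x) auto
    ultimately have "?p + ?q - ?r - (?q - ?r) \<in> J_plus n ?V"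
      by (rule J_plus_diff)
    moreover have "x_poly 1 2 * \<psi> (\<Phi>_poly 1 3 k l) \<in> J_plus n ?V"
      using n kl by (intro x_in_J_plus c) (auto simp: V)
    ultimately have "x_poly 1 2 * \<psi> (\<Phi>_poly 1 3 k l) - (?p + ?q - ?r - (?q - ?r)) \<in> J_plus n ?V"
      by (metis J_plus_diff)
    then have "x_poly 1 3 * \<psi> (\<Phi>_poly 1 2 k l) \<in> J_plus n ?V"
      by (simp add: algebra_simps)
    then have "\<psi> (\<Phi>_poly 1 2 k l) \<in> J_plus n ?V"
      by (rule x_nonzerodivisor[rotated 4]) (use n kl in \<open>auto intro!: c\<close>)
    then show ?thesis
      by (auto simp: J_plus_def V)
  qed
  then have "\<forall>kl\<in>{4..n} \<times> {4..n}. \<exists>e. e \<in> carrier (S_alg n) \<and> \<psi> (\<Phi>_poly 1 2 (fst kl) (snd kl)) - e * Var (XVar 1 2) \<in> J_ideal n"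
    by (metis mem_Times_iff)
  from bchoice[OF this] obtain e where e: "\<And>k l. k \<in> {4..n} \<Longrightarrow> l \<in> {4..n} \<Longrightarrow> e (k, l) \<in> carrier (S_alg n)"
    "\<And>k l. k \<in> {4..n} \<Longrightarrow> l \<in> {4..n} \<Longrightarrow> \<psi> (\<Phi>_poly 1 2 k l) - e (k, l) * Var (XVar 1 2) \<in> J_ideal n"
    by fastforce
  \<comment> \<open>The derivative of Phi_12kl in x_kl is x_12. As k \<ge> 4, no moved indeterminate
    occurs in any Phi_123l, and x_kl is the only one in Phi_12kl.\<close>
  define d where "d = (\<lambda>v. case v of YVar j \<Rightarrow> 0 | XVar k l \<Rightarrow> if k < 4 then 0 else e (k, l))"
  have "\<psi> (\<Phi>_poly 1 2 k l) - deriv_of d (\<Phi>_poly 1 2 k l) \<in> J_ideal n" if kl: "3 \<le> k" "k < l" "l \<le> n" for k l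
  proof (cases "k = 3")
    case True
    then have "deriv_of d (\<Phi>_poly 1 2 k l) = 0"
      using kl by (simp add: d_def \<Phi>_poly_def x_poly_def deriv_of_add deriv_of_diff deriv_of_mult)
    then show ?thesis
      using True 123[of l] kl by simp
  next
    case False
    then have "deriv_of d (\<Phi>_poly 1 2 k l) = e (k, l) * Var (XVar 1 2)"
      using kl by (simp add: d_def \<Phi>_poly_def x_poly_def deriv_of_add deriv_of_diff deriv_of_mult algebra_simps)
    then show ?thesis
      using e(2)[of k l] kl False by simp
  qed
  moreover have "derivation_S n (deriv_of d)"
    using e(1) n by (intro derivation_S_deriv_of) (auto simp: d_def vars_S_def carrier_S_zero)
  ultimately show thesis
    using that by blast
qed

text \<open>After multiplication by x_12, \<open>plucker_syzygy\<close> expresses Phi_1jkl and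
  Phi_2jkl through the Phi_12kl, and \<open>Phi_expand\<close> with p = 1, q = 2 expresses the rest
  through all of these. Then x_12 is cancelled.\<close>

lemma Phi_in_ker_mod_J:
  fixes \<psi> :: "'k::idom mpoly \<Rightarrow> 'k mpoly"
  assumes n: "6 \<le> n" and \<psi>: "hom_mod_J n \<psi>"
    and 12: "\<And>k l. 3 \<le> k \<Longrightarrow> k < l \<Longrightarrow> l \<le> n \<Longrightarrow> \<psi> (\<Phi>_poly 1 2 k l) \<in> J_ideal n"
    and i: "i \<in> {1..n}" "j \<in> {1..n}" "k \<in> {1..n}" "l \<in> {1..n}"
  shows "\<Phi>_poly i j k l \<in> ker_mod_J n \<psi>"
proof -
  have n3: "3 \<le> n" and one: "1 \<in> {1..n}" and two: "2 \<in> {1..n}"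
    using n by auto
  note cancel = ker_mod_J_cancel[OF n3 \<psi>]
  note closed = ker_mod_J_add[OF \<psi>] ker_mod_J_diff[OF \<psi>] ker_mod_J_mult[OF \<psi>] carrier_S_x
  have P12: "\<Phi>_poly 1 2 k l \<in> ker_mod_J n \<psi>" if kl: "k \<in> {1..n}" "l \<in> {1..n}" for k l
  proof -
    have less: "\<Phi>_poly 1 2 k l \<in> ker_mod_J n \<psi>" if "3 \<le> k" "k < l" "l \<le> n" for k l
      using 12[OF that] that one two by (auto simp: ker_mod_J_def intro!: Phi_in_J)
    consider "k = 1 \<or> k = 2 \<or> l = 1 \<or> l = 2 \<or> k = l" | "3 \<le> k" "k < l" | "3 \<le> l" "l < k"
      using kl unfolding atLeastAtMost_iff by linarith
    then show ?thesis
    proof cases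
      case 1
      then show ?thesis
        using ker_mod_J_zero[OF \<psi>] by auto
    next
      case 2
      then show ?thesis
        using less that by simp
    next
      case 3
      then show ?thesis
        using ker_mod_J_uminus[OF \<psi> less[of l k]] that by (simp add: Phi_swap(3)[of 1 2 k l])
    qed
  qed
  have P1: "\<Phi>_poly 1 j k l \<in> ker_mod_J n \<psi>" if j: "j \<in> {1..n}" "k \<in> {1..n}" "l \<in> {1..n}" for j k l
  proof (rule cancel)
    have "x_poly 1 2 * \<Phi>_poly 1 j k l = x_poly 1 j * \<Phi>_poly 1 2 k l - x_poly 1 k * \<Phi>_poly 1 2 j l + (x_poly 1 l * \<Phi>_poly 1 2 j k :: 'k mpoly)"
      using plucker_syzygy[of 1 2 j k l, where 'k = 'k] by (simp add: algebra_simps)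
    also have "\<dots> \<in> ker_mod_J n \<psi>"
      using j one by (intro closed P12)
    finally show "x_poly 1 2 * \<Phi>_poly 1 j k l \<in> ker_mod_J n \<psi>" .
  qed (use one j in \<open>intro Phi_in_J\<close>)
  have P2: "\<Phi>_poly 2 j k l \<in> ker_mod_J n \<psi>" if j: "j \<in> {1..n}" "k \<in> {1..n}" "l \<in> {1..n}" for j k l
  proof (rule cancel)
    have "x_poly 1 2 * \<Phi>_poly 2 j k l = x_poly 2 j * \<Phi>_poly 1 2 k l - x_poly 2 k * \<Phi>_poly 1 2 j l + (x_poly 2 l * \<Phi>_poly 1 2 j k :: 'k mpoly)"
      using plucker_syzygy[of 2 1 j k l, where 'k = 'k]
      by (simp add: algebra_simps Phi_swap(1)[of 2 1] x_poly_swap[of 2 1])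
    also have "\<dots> \<in> ker_mod_J n \<psi>"
      using j two by (intro closed P12)
    finally show "x_poly 1 2 * \<Phi>_poly 2 j k l \<in> ker_mod_J n \<psi>" .
  qed (use two j in \<open>intro Phi_in_J\<close>)
  show ?thesis
  proof (rule cancel)
    show "x_poly 1 2 * \<Phi>_poly i j k l \<in> ker_mod_J n \<psi>"
      unfolding Phi_expand[of 1 2] using i one two by (intro closed P12 P1 P2)
  qed (use i in \<open>intro Phi_in_J\<close>)
qed

section \<open>Relations between the values on the f_i\<close>

lemma f_combination_in_ker_mod_J:
  fixes \<psi> :: "'k::idom mpoly \<Rightarrow> 'k mpoly"
  assumes \<psi>: "hom_mod_J n \<psi>"
    and Phi: "\<And>i j k l. i \<in> {1..n} \<Longrightarrow> j \<in> {1..n} \<Longrightarrow> k \<in> {1..n} \<Longrightarrow> l \<in> {1..n} \<Longrightarrow> \<Phi>_poly i j k l \<in> ker_mod_J n \<psi>"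
    and i: "i \<in> {1..n}" "j \<in> {1..n}" "k \<in> {1..n}"
  shows "x_poly i j * f_poly n k - x_poly i k * f_poly n j + x_poly j k * f_poly n i \<in> ker_mod_J n \<psi>"
    and "x_poly i j * \<psi> (f_poly n k) - x_poly i k * \<psi> (f_poly n j) + x_poly j k * \<psi> (f_poly n i) \<in> J_ideal n"
proof -
  let ?s = "x_poly i j * f_poly n k - x_poly i k * f_poly n j + x_poly j k * f_poly n i :: 'k mpoly"
  \<comment> \<open>By \<open>f_syzygy\<close> the sum lies in the ideal of the Pfaffians, where
    \<psi> already vanishes modulo J.\<close>
  show s: "?s \<in> ker_mod_J n \<psi>"
    unfolding f_syzygy using i
    by (intro ker_mod_J_sum[OF \<psi>] ker_mod_J_mult[OF \<psi>] Phi carrier_S_y)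
  let ?xs = "[(x_poly i j, f_poly n k), (- x_poly i k, f_poly n j), (x_poly j k, f_poly n i)] :: ('k mpoly \<times> 'k mpoly) list"
  have xs: "\<forall>(a, f)\<in>set ?xs. a \<in> carrier (S_alg n) \<and> f \<in> J_ideal n"
    using i by (simp add: carrier_S_x carrier_S_uminus f_in_J)
  have sum: "(\<Sum>(a, f)\<leftarrow>?xs. a * f) = ?s"
    by (simp add: algebra_simps)
  have "\<psi> ?s \<in> J_ideal n"
    using s by (simp only: ker_mod_J_def mem_Collect_eq)
  then have "\<psi> ?s - (\<psi> ?s - (\<Sum>(a, f)\<leftarrow>?xs. a * \<psi> f)) \<in> J_ideal n"
    using hom_mod_J_sum_list(1)[OF \<psi> xs] unfolding sum by (rule J_diff)
  then show "x_poly i j * \<psi> (f_poly n k) - x_poly i k * \<psi> (f_poly n j) + x_poly j k * \<psi> (f_poly n i) \<in> J_ideal n"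
    by (simp add: algebra_simps)
qed

section \<open>Vanishing of the first cotangent cohomology\<close>

lemma S_a_minus:
  assumes "p \<in> carrier (S_alg n)" "q \<in> carrier (S_alg n)"
  shows "p \<ominus>\<^bsub>S_alg n\<^esub> q = (p - q :: 'k::comm_ring_1 mpoly)"
proof -
  interpret S: cring "S_alg n :: ('k, 'k mpoly) module"
    by (rule cring_S)
  have "\<ominus>\<^bsub>S_alg n\<^esub> q = - q"
    using assms by (intro S.minus_equality) (auto simp: S_alg_simps carrier_S_uminus)
  then show ?thesis
    by (simp add: a_minus_def S_alg_simps)
qed

lemma ideal_ker_mod_J:
  assumes "hom_mod_J n \<psi>"
  shows "ideal (ker_mod_J n \<psi>) (S_alg n)"
proof (rule ideal_S_I)
  show "ker_mod_J n \<psi> \<subseteq> carrier (S_alg n)"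
    using J_subset_carrier by (auto simp: ker_mod_J_def)
qed (use assms in \<open>auto intro: ker_mod_J_zero ker_mod_J_add ker_mod_J_mult\<close>)

lemma deriv_of_zero [simp]: "deriv_of d 0 = 0"
  using deriv_of_const[of d 0] by simp

lemma deriv_of_x_eq_0:
  "(\<And>i j. d (XVar i j) = 0) \<Longrightarrow> deriv_of d (x_poly i j) = 0"
  by (simp add: x_poly_def deriv_of_uminus)

text \<open>The remaining derivations move only the y, so they correct values on the f_i without
  disturbing the zeros on the Pfaffians.\<close>

lemma deriv_of_Phi_eq_0:
  "(\<And>i j. d (XVar i j) = 0) \<Longrightarrow> deriv_of d (\<Phi>_poly i j k l) = 0"
  by (simp add: \<Phi>_poly_def deriv_of_add deriv_of_diff deriv_of_mult deriv_of_x_eq_0)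

lemma deriv_of_f_eq_sum:
  "(\<And>i j. d (XVar i j) = 0) \<Longrightarrow> deriv_of d (f_poly n i) = (\<Sum>j=1..n. x_poly i j * d (YVar j))"
  by (simp add: f_poly_def y_poly_def deriv_of_sum deriv_of_mult deriv_of_x_eq_0)

lemma derivation_kills_f1:
  fixes \<psi> :: "'k::idom mpoly \<Rightarrow> 'k mpoly"
  assumes n: "6 \<le> n" and \<psi>: "hom_mod_J n \<psi>"
    and Phi: "\<And>i j k l. i \<in> {1..n} \<Longrightarrow> j \<in> {1..n} \<Longrightarrow> k \<in> {1..n} \<Longrightarrow> l \<in> {1..n} \<Longrightarrow> \<Phi>_poly i j k l \<in> ker_mod_J n \<psi>"
  obtains D where "derivation_S n D" "\<And>i j k l. D (\<Phi>_poly i j k l) = 0" "\<psi> (f_poly n 1) - D (f_poly n 1) \<in> J_ideal n"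
proof -
  let ?V = "schubert_vars n 2 3"
  have V: "?V = XVar 1 ` {2..n}"
    using n by (simp add: schubert_vars_expand)
  have c: "\<psi> (f_poly n i) \<in> carrier (S_alg n)" if "i \<in> {1..n}" for i
    using \<psi> f_in_J[OF that] unfolding hom_mod_J_def by blast
  have "x_poly 1 2 * \<psi> (f_poly n 3) - x_poly 1 3 * \<psi> (f_poly n 2) + x_poly 2 3 * \<psi> (f_poly n 1) \<in> J_plus n ?V"
    using n by (intro J_subset_J_plus f_combination_in_ker_mod_J(2)[OF \<psi> Phi]) auto
  moreover have "x_poly 1 2 * \<psi> (f_poly n 3) - x_poly 1 3 * \<psi> (f_poly n 2) \<in> J_plus n ?V"
    using n by (intro J_plus_diff x_in_J_plus c) (auto simp: V)
  ultimately have "x_poly 2 3 * \<psi> (f_poly n 1) \<in> J_plus n ?V"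
    using J_plus_diff by fastforce
  then have "\<psi> (f_poly n 1) \<in> J_plus n ?V"
    by (rule x_nonzerodivisor[rotated 4]) (use n in \<open>auto intro!: c\<close>)
  then obtain e where e: "\<forall>v\<in>?V. e v \<in> carrier (S_alg n)" "\<psi> (f_poly n 1) - (\<Sum>v\<in>?V. e v * Var v) \<in> J_ideal n"
    by (auto simp: J_plus_def)
  \<comment> \<open>The derivative of f_1 in y_j is x_1j, so the cofactor of x_1j becomes the value
    on y_j; y_1 does not occur in f_1.\<close>
  define d where "d = (\<lambda>v. case v of XVar i j \<Rightarrow> 0 | YVar j \<Rightarrow> if j = 1 then 0 else e (XVar 1 j))"
  have dX: "d (XVar i j) = 0" for i j
    by (simp add: d_def)
  have "{1..n} = insert 1 {2..n}"
    using n by auto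
  then have "deriv_of d (f_poly n 1) = (\<Sum>j=2..n. e (XVar 1 j) * Var (XVar 1 j))"
    unfolding deriv_of_f_eq_sum[of d, OF dX] by (simp add: d_def x_poly_def mult.commute)
  also have "\<dots> = (\<Sum>v\<in>?V. e v * Var v)"
    unfolding V by (subst sum.reindex) (auto simp: inj_on_def)
  finally have "\<psi> (f_poly n 1) - deriv_of d (f_poly n 1) \<in> J_ideal n"
    using e(2) by simp
  moreover have "derivation_S n (deriv_of d)"
    using e(1) by (intro derivation_S_deriv_of) (auto simp: d_def V vars_S_def carrier_S_zero)
  ultimately show thesis
    using that deriv_of_Phi_eq_0[of d, OF dX] by blast
qed

lemma derivation_kills_f2:
  fixes \<psi> :: "'k::idom mpoly \<Rightarrow> 'k mpoly"
  assumes n: "6 \<le> n" and \<psi>: "hom_mod_J n \<psi>"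
    and Phi: "\<And>i j k l. i \<in> {1..n} \<Longrightarrow> j \<in> {1..n} \<Longrightarrow> k \<in> {1..n} \<Longrightarrow> l \<in> {1..n} \<Longrightarrow> \<Phi>_poly i j k l \<in> ker_mod_J n \<psi>"
    and f1: "\<psi> (f_poly n 1) \<in> J_ideal n"
  obtains D where "derivation_S n D" "\<And>i j k l. D (\<Phi>_poly i j k l) = 0" "D (f_poly n 1) = 0"
    "\<psi> (f_poly n 2) - D (f_poly n 2) \<in> J_ideal n"
proof -
  let ?V = "schubert_vars n 1 3"
  have V: "?V = {XVar 1 2}"
    using n by (simp add: schubert_vars_expand)
  have c: "\<psi> (f_poly n i) \<in> carrier (S_alg n)" if "i \<in> {1..n}" for i
    using \<psi> f_in_J[OF that] unfolding hom_mod_J_def by blast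
  have "x_poly 1 2 * \<psi> (f_poly n 3) - x_poly 1 3 * \<psi> (f_poly n 2) + x_poly 2 3 * \<psi> (f_poly n 1) \<in> J_plus n ?V"
    using n by (intro J_subset_J_plus f_combination_in_ker_mod_J(2)[OF \<psi> Phi]) auto
  moreover have "x_poly 1 2 * \<psi> (f_poly n 3) + x_poly 2 3 * \<psi> (f_poly n 1) \<in> J_plus n ?V"
  proof (rule J_plus_add)
    show "x_poly 1 2 * \<psi> (f_poly n 3) \<in> J_plus n ?V"
      using n by (intro x_in_J_plus c) (auto simp: V)
    show "x_poly 2 3 * \<psi> (f_poly n 1) \<in> J_plus n ?V"
      using n f1 by (intro J_subset_J_plus J_mult carrier_S_x) auto
  qed
  ultimately have "x_poly 1 3 * \<psi> (f_poly n 2) \<in> J_plus n ?V"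
    using J_plus_diff by fastforce
  then have "\<psi> (f_poly n 2) \<in> J_plus n ?V"
    by (rule x_nonzerodivisor[rotated 4]) (use n in \<open>auto intro!: c\<close>)
  then obtain e where e: "e \<in> carrier (S_alg n)" "\<psi> (f_poly n 2) - e * Var (XVar 1 2) \<in> J_ideal n"
    by (auto simp: J_plus_def V)
  \<comment> \<open>The derivative of f_2 in y_1 is x_21 = - x_12, whence the sign. Moving only y_1
    leaves f_1 unaffected.\<close>
  define d where "d = (\<lambda>v. if v = YVar 1 then - e else 0)"
  have dX: "d (XVar i j) = 0" for i j
    by (simp add: d_def)
  have "{1..n} = insert 1 {2..n}"
    using n by auto
  then have D: "deriv_of d (f_poly n i) = - (x_poly i 1 * e)" for i
    unfolding deriv_of_f_eq_sum[of d, OF dX] by (simp add: d_def)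
  have "\<psi> (f_poly n 2) - deriv_of d (f_poly n 2) \<in> J_ideal n"
    using e(2) by (simp add: D x_poly_def mult.commute)
  moreover have "deriv_of d (f_poly n 1) = 0"
    by (simp add: D)
  moreover have "derivation_S n (deriv_of d)"
    using e(1) by (intro derivation_S_deriv_of) (auto simp: d_def carrier_S_zero carrier_S_uminus)
  ultimately show thesis
    using that deriv_of_Phi_eq_0[of d, OF dX] by blast
qed

text \<open>Modulo the Pfaffians x_12 f_k = x_1k f_2 - x_2k f_1, so x_12 f_k is in the kernel, and
  x_12 can be cancelled.\<close>

lemma J_subset_ker_mod_J:
  fixes \<psi> :: "'k::idom mpoly \<Rightarrow> 'k mpoly"
  assumes n: "6 \<le> n" and \<psi>: "hom_mod_J n \<psi>"
    and Phi: "\<And>i j k l. i \<in> {1..n} \<Longrightarrow> j \<in> {1..n} \<Longrightarrow> k \<in> {1..n} \<Longrightarrow> l \<in> {1..n} \<Longrightarrow> \<Phi>_poly i j k l \<in> ker_mod_J n \<psi>"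
    and f: "\<psi> (f_poly n 1) \<in> J_ideal n" "\<psi> (f_poly n 2) \<in> J_ideal n"
  shows "J_ideal n \<subseteq> ker_mod_J n \<psi>"
proof (rule J_minimal[OF ideal_ker_mod_J[OF \<psi>] Phi])
  fix k assume k: "k \<in> {1..n}"
  have one: "1 \<in> {1..n}" and two: "2 \<in> {1..n}" and n3: "3 \<le> n"
    using n by auto
  have f12: "f_poly n 1 \<in> ker_mod_J n \<psi>" "f_poly n 2 \<in> ker_mod_J n \<psi>"
    using f f_in_J[OF one] f_in_J[OF two] by (simp_all add: ker_mod_J_def)
  have "x_poly 1 2 * f_poly n k - x_poly 1 k * f_poly n 2 + x_poly 2 k * f_poly n 1
      + x_poly 1 k * f_poly n 2 - x_poly 2 k * f_poly n 1 \<in> ker_mod_J n \<psi>"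
    using one two k
    by (intro ker_mod_J_diff[OF \<psi>] ker_mod_J_add[OF \<psi> f_combination_in_ker_mod_J(1)[OF \<psi> Phi]]
        ker_mod_J_mult[OF \<psi>] f12 carrier_S_x)
  then have "x_poly 1 2 * f_poly n k \<in> ker_mod_J n \<psi>"
    by simp
  then show "f_poly n k \<in> ker_mod_J n \<psi>"
    by (rule ker_mod_J_cancel[OF n3 \<psi> f_in_J[OF k]])
qed

lemma hom_mod_J_eq_derivation:
  fixes \<psi> :: "'k::idom mpoly \<Rightarrow> 'k mpoly"
  assumes n: "6 \<le> n" and \<psi>: "hom_mod_J n \<psi>"
  obtains D where "derivation_S n D" "\<And>f. f \<in> J_ideal n \<Longrightarrow> \<psi> f - D f \<in> J_ideal n"
proof -
  obtain D1 where D1: "derivation_S n D1" "\<psi> (\<Phi>_poly 1 2 3 4) - D1 (\<Phi>_poly 1 2 3 4) \<in> J_ideal n"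
    by (rule derivation_kills_1234[OF n \<psi>])
  define \<psi>1 where "\<psi>1 = (\<lambda>f. \<psi> f - D1 f)"
  have \<psi>1: "hom_mod_J n \<psi>1" "\<psi>1 (\<Phi>_poly 1 2 3 4) \<in> J_ideal n"
    using hom_mod_J_diff_derivation[OF \<psi> D1(1)] D1(2) by (simp_all add: \<psi>1_def)
  obtain D2 where D2: "derivation_S n D2" "\<And>l. l \<in> {4..n} \<Longrightarrow> \<psi>1 (\<Phi>_poly 1 2 3 l) - D2 (\<Phi>_poly 1 2 3 l) \<in> J_ideal n"
    using derivation_kills_123[OF n \<psi>1] by blast
  define \<psi>2 where "\<psi>2 = (\<lambda>f. \<psi>1 f - D2 f)"
  have \<psi>2: "hom_mod_J n \<psi>2" "\<And>l. l \<in> {4..n} \<Longrightarrow> \<psi>2 (\<Phi>_poly 1 2 3 l) \<in> J_ideal n"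
    using hom_mod_J_diff_derivation[OF \<psi>1(1) D2(1)] D2(2) by (simp_all add: \<psi>2_def)
  obtain D3 where D3: "derivation_S n D3"
    "\<And>k l. 3 \<le> k \<Longrightarrow> k < l \<Longrightarrow> l \<le> n \<Longrightarrow> \<psi>2 (\<Phi>_poly 1 2 k l) - D3 (\<Phi>_poly 1 2 k l) \<in> J_ideal n"
    using derivation_kills_12[OF n \<psi>2] by blast
  define \<psi>3 where "\<psi>3 = (\<lambda>f. \<psi>2 f - D3 f)"
  have \<psi>3: "hom_mod_J n \<psi>3" "\<And>k l. 3 \<le> k \<Longrightarrow> k < l \<Longrightarrow> l \<le> n \<Longrightarrow> \<psi>3 (\<Phi>_poly 1 2 k l) \<in> J_ideal n"
    using hom_mod_J_diff_derivation[OF \<psi>2(1) D3(1)] D3(2) by (simp_all add: \<psi>3_def)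
  have Phi3: "\<Phi>_poly i j k l \<in> ker_mod_J n \<psi>3"
    if "i \<in> {1..n}" "j \<in> {1..n}" "k \<in> {1..n}" "l \<in> {1..n}" for i j k l
    by (rule Phi_in_ker_mod_J[OF n \<psi>3(1)]) (use \<psi>3(2) that in auto)
  obtain D4 where D4: "derivation_S n D4" "\<And>i j k l. D4 (\<Phi>_poly i j k l) = 0"
    "\<psi>3 (f_poly n 1) - D4 (f_poly n 1) \<in> J_ideal n"
    using derivation_kills_f1[OF n \<psi>3(1) Phi3] by blast
  define \<psi>4 where "\<psi>4 = (\<lambda>f. \<psi>3 f - D4 f)"
  have \<psi>4: "hom_mod_J n \<psi>4" "\<psi>4 (f_poly n 1) \<in> J_ideal n"
    using hom_mod_J_diff_derivation[OF \<psi>3(1) D4(1)] D4(3) by (simp_all add: \<psi>4_def)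
  have Phi4: "\<Phi>_poly i j k l \<in> ker_mod_J n \<psi>4"
    if "i \<in> {1..n}" "j \<in> {1..n}" "k \<in> {1..n}" "l \<in> {1..n}" for i j k l
    using Phi3[OF that] D4(2) by (simp add: ker_mod_J_def \<psi>4_def)
  obtain D5 where D5: "derivation_S n D5" "\<And>i j k l. D5 (\<Phi>_poly i j k l) = 0"
    "D5 (f_poly n 1) = 0" "\<psi>4 (f_poly n 2) - D5 (f_poly n 2) \<in> J_ideal n"
    using derivation_kills_f2[OF n \<psi>4(1) Phi4 \<psi>4(2)] by blast
  define \<psi>5 where "\<psi>5 = (\<lambda>f. \<psi>4 f - D5 f)"
  have \<psi>5: "hom_mod_J n \<psi>5" "\<psi>5 (f_poly n 1) \<in> J_ideal n" "\<psi>5 (f_poly n 2) \<in> J_ideal n"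
    using hom_mod_J_diff_derivation[OF \<psi>4(1) D5(1)] \<psi>4(2) D5(3,4) by (simp_all add: \<psi>5_def)
  have "\<Phi>_poly i j k l \<in> ker_mod_J n \<psi>5"
    if "i \<in> {1..n}" "j \<in> {1..n}" "k \<in> {1..n}" "l \<in> {1..n}" for i j k l
    using Phi4[OF that] D5(2) by (simp add: ker_mod_J_def \<psi>5_def)
  then have "J_ideal n \<subseteq> ker_mod_J n \<psi>5"
    by (rule J_subset_ker_mod_J[OF n \<psi>5(1) _ \<psi>5(2,3)])
  then have "\<psi> f - (D1 f + (D2 f + (D3 f + (D4 f + D5 f)))) \<in> J_ideal n" if "f \<in> J_ideal n" for f
    using that by (auto simp: ker_mod_J_def \<psi>5_def \<psi>4_def \<psi>3_def \<psi>2_def \<psi>1_def algebra_simps)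
  moreover have "derivation_S n (\<lambda>f. D1 f + (D2 f + (D3 f + (D4 f + D5 f))))"
    by (intro derivation_S_add D1 D2 D3 D4 D5)
  ultimately show thesis
    using that by blast
qed

section \<open>Rigidity as surjectivity onto the homomorphisms\<close>

lemma (in comm_group) trivial_group_Mod_carrier: "trivial_group (G Mod carrier G)"
proof -
  have "group (G Mod carrier G)"
    by (intro normal.factorgroup_is_group subgroup_imp_normal subgroup_self)
  moreover have "carrier (G Mod carrier G) = {\<one>\<^bsub>G Mod carrier G\<^esub>}"
    using coset_join2[OF _ subgroup_self] by (auto simp: FactGroup_def RCOSETS_def)
  ultimately show ?thesis
    by (simp add: trivial_group_def)
qed

text \<open>The image of the derivations lies in the group of homomorphisms by
  \<open>submodule_der_to_Hom\<close>. If it exhausts this group, the cokernel is a group modulo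
  itself.\<close>

lemma rigidI:
  assumes K: "algebra K S" and I: "ideal I S"
    and surj: "carrier (Hom_module S I (quot_module S I)) \<subseteq> der_to_Hom S I ` Der K S"
  shows "rigid K S I"
proof -
  let ?H = "Hom_module S I (quot_module S I)"
  have S: "cring S"
    by (rule algebra.axioms(2)[OF K])
  interpret H: module S ?H
    by (intro module_Hom_module module_quot_module S I)
  have "der_to_Hom S I ` Der K S \<subseteq> carrier ?H"
    using H.submoduleE(1)[OF submodule_der_to_Hom[OF K I]] .
  then have "der_to_Hom S I ` Der K S = carrier (add_monoid ?H)"
    using surj by auto
  then show ?thesis
    using comm_group.trivial_group_Mod_carrier[OF H.a_comm_group]
    by (simp add: rigid_def T1_def A_FactGroup_def)
qed

lemma J_coset_eq_iff:
  fixes p q :: "'k::comm_ring_1 mpoly"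
  assumes "p \<in> carrier (S_alg n)" "q \<in> carrier (S_alg n)"
  shows "J_ideal n +>\<^bsub>S_alg n\<^esub> p = J_ideal n +>\<^bsub>S_alg n\<^esub> q \<longleftrightarrow> p - q \<in> J_ideal n"
  using ring.quotient_eq_iff_same_a_r_cos[OF cring.axioms(1)[OF cring_S] ideal_J assms] assms
  by (simp add: S_a_minus)

text \<open>Representatives are chosen for each f separately; \<open>J_coset_eq_iff\<close> turns
  the laws of \<phi> into congruences modulo J.\<close>

lemma Hom_module_J_lift:
  fixes \<phi> :: "'k::comm_ring_1 mpoly \<Rightarrow> 'k mpoly set"
  assumes \<phi>: "\<phi> \<in> carrier (Hom_module (S_alg n) (J_ideal n) (quot_module (S_alg n) (J_ideal n)))"
  obtains \<psi> where "hom_mod_J n \<psi>" "\<And>f. f \<in> J_ideal n \<Longrightarrow> \<phi> f = J_ideal n +>\<^bsub>S_alg n\<^esub> \<psi> f"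
proof -
  let ?S = "S_alg n :: ('k, 'k mpoly) module" and ?c = "\<lambda>p. J_ideal n +>\<^bsub>S_alg n\<^esub> (p :: 'k mpoly)"
  interpret J: ideal "J_ideal n" ?S
    by (rule ideal_J)
  have h: "?c \<in> ring_hom ?S (?S Quot J_ideal n)"
    by (rule J.rcos_ring_hom)
  have "\<exists>p. p \<in> carrier ?S \<and> \<phi> f = ?c p" if "f \<in> J_ideal n" for f
  proof -
    have "\<phi> f \<in> carrier (?S Quot J_ideal n)"
      using \<phi> that by (auto simp: Hom_module_def quot_module_def)
    then show ?thesis
      by (auto simp: FactRing_def A_RCOSETS_def')
  qed
  then have "\<forall>f\<in>J_ideal n. \<exists>p. p \<in> carrier ?S \<and> \<phi> f = ?c p"
    by blast
  from bchoice[OF this] obtain \<psi> where \<psi>: "\<And>f. f \<in> J_ideal n \<Longrightarrow> \<psi> f \<in> carrier ?S"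
    "\<And>f. f \<in> J_ideal n \<Longrightarrow> \<phi> f = ?c (\<psi> f)"
    by blast
  have "hom_mod_J n \<psi>"
    unfolding hom_mod_J_def
  proof (intro conjI ballI)
    fix f g :: "'k mpoly" assume fg: "f \<in> J_ideal n" "g \<in> J_ideal n"
    have "?c (\<psi> (f + g)) = \<phi> (f \<oplus>\<^bsub>?S\<^esub> g)"
      using \<psi>(2)[OF J_add[OF fg]] by (simp add: S_alg_simps)
    also have "\<dots> = \<phi> f \<oplus>\<^bsub>?S Quot J_ideal n\<^esub> \<phi> g"
      using \<phi> fg by (simp add: Hom_module_def quot_module_def)
    also have "\<dots> = ?c (\<psi> f + \<psi> g)"
      using ring_hom_add[OF h \<psi>(1)[OF fg(1)] \<psi>(1)[OF fg(2)]] \<psi>(2) fg by (simp add: S_alg_simps)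
    finally show "\<psi> (f + g) - (\<psi> f + \<psi> g) \<in> J_ideal n"
      using \<psi>(1) fg J_add[OF fg] by (subst (asm) J_coset_eq_iff) (auto simp: carrier_S_add)
  next
    fix a f :: "'k mpoly" assume af: "a \<in> carrier ?S" "f \<in> J_ideal n"
    have "?c (\<psi> (a * f)) = \<phi> (a \<otimes>\<^bsub>?S\<^esub> f)"
      using \<psi>(2)[OF J_mult[OF af]] by (simp add: S_alg_simps)
    also have "\<dots> = ?c a \<otimes>\<^bsub>?S Quot J_ideal n\<^esub> \<phi> f"
      using \<phi> af by (simp add: Hom_module_def quot_module_def)
    also have "\<dots> = ?c (a * \<psi> f)"
      using ring_hom_mult[OF h af(1) \<psi>(1)[OF af(2)]] \<psi>(2) af by (simp add: S_alg_simps)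
    finally show "\<psi> (a * f) - a * \<psi> f \<in> J_ideal n"
      using \<psi>(1) af J_mult[OF af] by (subst (asm) J_coset_eq_iff) (auto simp: carrier_S_mult)
  qed (rule \<psi>(1))
  then show thesis
    using \<psi>(2) that by blast
qed

lemma derivation_S_imp_Der:
  fixes D :: "'k::comm_ring_1 mpoly \<Rightarrow> 'k mpoly"
  assumes D: "derivation_S n D"
  shows "restrict D (carrier (S_alg n)) \<in> Der ring_of_type_algebra (S_alg n)"
  using D by (auto simp: Der_def derivation_S_def S_alg_simps carrier_S_closed)

theorem theorem5p1:
  fixes n :: nat
  assumes "n \<ge> 6"
  shows "rigid ring_of_type_algebra (S_alg n :: ('k::alg_closed_field, 'k mpoly) module) (J_ideal n)"
proof (rule rigidI[OF algebra_S ideal_J subsetI])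
  let ?S = "S_alg n :: ('k, 'k mpoly) module"
  fix \<phi> assume \<phi>: "\<phi> \<in> carrier (Hom_module ?S (J_ideal n) (quot_module ?S (J_ideal n)))"
  obtain \<psi> where \<psi>: "hom_mod_J n \<psi>" "\<And>f. f \<in> J_ideal n \<Longrightarrow> \<phi> f = J_ideal n +>\<^bsub>?S\<^esub> \<psi> f"
    using Hom_module_J_lift[OF \<phi>] by blast
  obtain D where D: "derivation_S n D" "\<And>f. f \<in> J_ideal n \<Longrightarrow> \<psi> f - D f \<in> J_ideal n"
    using hom_mod_J_eq_derivation[OF assms \<psi>(1)] by blast
  \<comment> \<open>Both sides are extensional on J, and on J their cosets agree because \<psi> f -
    D f lies in J.\<close>
  have "\<phi> = der_to_Hom ?S (J_ideal n) (restrict D (carrier ?S))"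
  proof (rule extensionalityI)
    show "\<phi> \<in> extensional (J_ideal n)"
      using \<phi> by (auto simp: Hom_module_def PiE_def)
    show "\<phi> f = der_to_Hom ?S (J_ideal n) (restrict D (carrier ?S)) f" if f: "f \<in> J_ideal n" for f
    proof -
      have "\<psi> f \<in> carrier ?S" "f \<in> carrier ?S"
        using \<psi>(1) f J_subset_carrier by (auto simp: hom_mod_J_def)
      then show ?thesis
        using \<psi>(2)[OF f] D(2)[OF f] D(1) f J_coset_eq_iff[of "\<psi> f" n "D f"]
        by (auto simp: der_to_Hom_def derivation_S_def)
    qed
  qed (simp add: der_to_Hom_def)
  then show "\<phi> \<in> der_to_Hom ?S (J_ideal n) ` Der ring_of_type_algebra ?S"
    using derivation_S_imp_Der[OF D(1)] by blast
qed

end
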